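(* Let $0<M_1<M_2$ and $k<p/2$. Let $\Theta_1(k)=\{\Sigma\succeq0:\sigma_{ij}=0\text{ whenever }|i-j|>k,\ M_1\le\|\Sigma\|_2\le M_2\}$, and let $\Theta_2(k)$ be the set of $\Sigma\succeq0$ with $M_1\le\|\Sigma\|_2\le M_2$ such that for some $I\subseteq[p]$ with $|I|\le k$, all nonzero off-diagonal entries $\sigma_{ij}$ have $i,j\in I$. For $\Sigma^*$ let $P_{\Sigma^*}=\mathcal{N}(0,\Sigma^* )$ and consider data $X_1,\dots,X_n\stackrel{i.i.d.}{\sim}P$ with $W(P,P_{\Sigma^*})\le\epsilon$. Then there exist constants $C_1,c_1>0$ such that $$\inf_{\widehat\Sigma}\sup_{\Sigma^*\in\Theta_1(k),\;P:W(P_{\Sigma^*},P)\le\epsilon}\mathbb{P}\left(\|\Sigma^*-\widehat\Sigma\|_2\ge C_1\left(\sqrt{\frac{k+\log p}n}\vee\epsilon\right)\right)\ge c_1,$$ and constants $C_2,c_2>0$ such that $$\inf_{\widehat\Sigma}\sup_{\Sigma^*\in\Theta_2(k),\;P:W(P_{\Sigma^*},P)\le\epsilon}\mathbb{P}\left(\|\Sigma^*-\widehat\Sigma\|_2\ge C_2\left(\sqrt{\frac{k+k\log\frac pk}n}\vee\epsilon\right)\right)\ge c_2,$$ the infima being over all estimators based on $X_1,\dots,X_n$.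
   Context: $\|\cdot\|_2$ is the spectral norm; $W$ is the Wasserstein-1 distance $W(P,Q)=\inf_\Pi\mathbb{E}_\Pi\|X-Y\|_2$ over couplings.
   Formalization: Both bounds are stated only when the rate (the maximum of the square root and ε) is at most a constant c0>0 depending on M1, M2: for very large rate, e.g. ε>M2/C, the estimator 0 has error at most M2, so the bound fails with uniform constants. *)

theory Defs
  imports "HOL-Probability.Probability"
begin

text \<open>Vectors in R^p are functions nat => real (only coordinates < p matter),
  p x p matrices are functions nat => nat => real (only entries i,j < p matter).\<close>

definition Rp :: "nat \<Rightarrow> (nat \<Rightarrow> real) measure" where
  "Rp p = PiM {..<p} (\<lambda>_. lborel)"

definition vnorm :: "nat \<Rightarrow> (nat \<Rightarrow> real) \<Rightarrow> real" where
  "vnorm p x = sqrt (\<Sum>i<p. (x i)\<^sup>2)"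

definition mat_vec :: "nat \<Rightarrow> (nat \<Rightarrow> nat \<Rightarrow> real) \<Rightarrow> (nat \<Rightarrow> real) \<Rightarrow> (nat \<Rightarrow> real)" where
  "mat_vec p A x = (\<lambda>i. \<Sum>j<p. A i j * x j)"

definition spec_norm :: "nat \<Rightarrow> (nat \<Rightarrow> nat \<Rightarrow> real) \<Rightarrow> real" where
  "spec_norm p A = Sup {vnorm p (mat_vec p A x) | x. vnorm p x \<le> 1}"

definition psd :: "nat \<Rightarrow> (nat \<Rightarrow> nat \<Rightarrow> real) \<Rightarrow> bool" where
  "psd p S \<longleftrightarrow> (\<forall>i<p. \<forall>j<p. S i j = S j i) \<and>
     (\<forall>x. 0 \<le> (\<Sum>i<p. \<Sum>j<p. x i * S i j * x j))"

definition Theta1 :: "nat \<Rightarrow> nat \<Rightarrow> real \<Rightarrow> real \<Rightarrow> (nat \<Rightarrow> nat \<Rightarrow> real) set" where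
  "Theta1 p k M1 M2 = {S. psd p S \<and>
     (\<forall>i<p. \<forall>j<p. \<bar>int i - int j\<bar> > int k \<longrightarrow> S i j = 0) \<and>
     M1 \<le> spec_norm p S \<and> spec_norm p S \<le> M2}"

definition Theta2 :: "nat \<Rightarrow> nat \<Rightarrow> real \<Rightarrow> real \<Rightarrow> (nat \<Rightarrow> nat \<Rightarrow> real) set" where
  "Theta2 p k M1 M2 = {S. psd p S \<and> M1 \<le> spec_norm p S \<and> spec_norm p S \<le> M2 \<and>
     (\<exists>I. I \<subseteq> {..<p} \<and> card I \<le> k \<and>
        (\<forall>i<p. \<forall>j<p. i \<noteq> j \<and> S i j \<noteq> 0 \<longrightarrow> i \<in> I \<and> j \<in> I))}"

text \<open>A square-root factor A of S (S = A A^T), used to define N(0,S) for possibly singular S.\<close>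
definition psd_factor :: "nat \<Rightarrow> (nat \<Rightarrow> nat \<Rightarrow> real) \<Rightarrow> (nat \<Rightarrow> nat \<Rightarrow> real)" where
  "psd_factor p S = (SOME A. \<forall>i<p. \<forall>j<p. S i j = (\<Sum>l<p. A i l * A j l))"

definition gaussian :: "nat \<Rightarrow> (nat \<Rightarrow> nat \<Rightarrow> real) \<Rightarrow> (nat \<Rightarrow> real) measure" where
  "gaussian p S = distr (PiM {..<p} (\<lambda>_. std_normal_distribution)) (Rp p)
      (\<lambda>z. \<lambda>i\<in>{..<p}. \<Sum>j<p. psd_factor p S i j * z j)"

definition couplings :: "nat \<Rightarrow> (nat \<Rightarrow> real) measure \<Rightarrow> (nat \<Rightarrow> real) measure
    \<Rightarrow> ((nat \<Rightarrow> real) \<times> (nat \<Rightarrow> real)) measure set" where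
  "couplings p P Q = {\<pi>. prob_space \<pi> \<and> sets \<pi> = sets (Rp p \<Otimes>\<^sub>M Rp p) \<and>
      distr \<pi> (Rp p) fst = P \<and> distr \<pi> (Rp p) snd = Q}"

definition wass1 :: "nat \<Rightarrow> (nat \<Rightarrow> real) measure \<Rightarrow> (nat \<Rightarrow> real) measure \<Rightarrow> ennreal" where
  "wass1 p P Q = (INF \<pi>\<in>couplings p P Q.
      \<integral>\<^sup>+ xy. ennreal (vnorm p (\<lambda>i. fst xy i - snd xy i)) \<partial>\<pi>)"

definition contam :: "nat \<Rightarrow> (nat \<Rightarrow> nat \<Rightarrow> real) \<Rightarrow> real \<Rightarrow> (nat \<Rightarrow> real) measure set" where
  "contam p S \<epsilon> = {P. prob_space P \<and> sets P = sets (Rp p) \<and>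
       wass1 p (gaussian p S) P \<le> ennreal \<epsilon>}"

text \<open>Sample space (R^p)^n; a sample x has x m = X_(m+1).\<close>
definition sample_space :: "nat \<Rightarrow> nat \<Rightarrow> (nat \<Rightarrow> nat \<Rightarrow> real) measure" where
  "sample_space n p = PiM {..<n} (\<lambda>_. Rp p)"

definition estimator :: "nat \<Rightarrow> nat \<Rightarrow> ((nat \<Rightarrow> nat \<Rightarrow> real) \<Rightarrow> (nat \<Rightarrow> nat \<Rightarrow> real)) \<Rightarrow> bool" where
  "estimator n p Sh \<longleftrightarrow> (\<forall>a<p. \<forall>b<p. (\<lambda>x. Sh x a b) \<in> borel_measurable (sample_space n p))"

definition err_prob :: "nat \<Rightarrow> nat \<Rightarrow> (nat \<Rightarrow> real) measure \<Rightarrow> (nat \<Rightarrow> nat \<Rightarrow> real)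
    \<Rightarrow> ((nat \<Rightarrow> nat \<Rightarrow> real) \<Rightarrow> (nat \<Rightarrow> nat \<Rightarrow> real)) \<Rightarrow> real \<Rightarrow> real" where
  "err_prob n p P S Sh t = measure (PiM {..<n} (\<lambda>_. P))
     {x \<in> space (PiM {..<n} (\<lambda>_. P)). t \<le> spec_norm p (\<lambda>i j. S i j - Sh x i j)}"

end

(* For the statistical rate, N(0, M1 I) is tested against the uniform mixture of the laws
   N(0, M1 (I + d v v^T))^n, where v has one entry +-1/sqrt(s) in each of s blocks of b coordinates.
   Writing N(0, I + d v v^T) as the law of z + sqrt(d) g v with an independent scalar Gaussian g gives
   its likelihood ratio as a Gaussian average of exponentials, hence the mixed second moment
   (1 - d^2 <v,u>^2)^(-n/2) <= exp(n d^2 <v,u>^2). Averaged over the prior this stays bounded as long as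
   n d^2 is at most a small multiple of s (1 + ln b), because the coordinatewise products of two
   independent draws are sub-Gaussian with variance proxy of order 1 / (1 + ln b). Le Cam's method then
   gives the rate d, with (s, b) = (1, p) or (k, 1) for the banded class and (k, p div k) for the sparse
   class. For the rate epsilon, two singular Gaussians supported on the first coordinate, at
   Wasserstein distance at most epsilon, share a contaminated law.
   That N(0, S) does not depend on the chosen factor of S follows from a uniqueness theorem for
   characteristic functions on finite products. *)
theory Submission
  imports Defs
begin

subsection \<open>Characteristic functions on finite products\<close>

text \<open>The estimator 0 never errs by more than \<open>M2\<close> on either class, so a bound by
  a multiple of the rate can hold only while the rate is capped; hence \<open>c0\<close>, the same
  for all \<open>n\<close>, \<open>p\<close>, \<open>k\<close> and \<epsilon>. Keeping the
  likelihood ratio as an average over one extra scalar Gaussian means that neither a determinant nor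
  an inverse covariance is ever computed. One signed position per block, in place of a random
  support, makes the blocks independent, so exponential moments over the prior factorise. The number
  s (1 + ln b) measures what such a prior hides, namely s signs and s positions among b, and both
  statistical rates match it up to a factor 4.\<close>

lemma char_weighted_distr:
  fixes h X :: "'a \<Rightarrow> real"
  assumes "prob_space M" and [measurable]: "h \<in> borel_measurable M" "X \<in> borel_measurable M"
    and h: "\<And>x. 0 \<le> h x" "\<And>x. h x \<le> C"
  shows "char (distr (density M (\<lambda>x. ennreal (h x))) borel X) s =
    Complex (\<integral>x. h x * cos (s * X x) \<partial>M) (\<integral>x. h x * sin (s * X x) \<partial>M)"
proof -
  interpret prob_space M by fact
  have C: "norm (h x) \<le> C" for x using h[of x] by auto
  have int [simp]: "integrable M (\<lambda>x. h x *\<^sub>R iexp (s * X x))"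
    by (rule integrable_const_bound[where B=C]) (use C in auto)
  have "char (distr (density M (\<lambda>x. ennreal (h x))) borel X) s = (\<integral>x. h x *\<^sub>R iexp (s * X x) \<partial>M)"
    unfolding char_def by (subst integral_distr, simp, simp, subst integral_density) (auto simp: h)
  also have "\<dots> = Complex (\<integral>x. h x * cos (s * X x) \<partial>M) (\<integral>x. h x * sin (s * X x) \<partial>M)"
    using integral_Re[OF int] integral_Im[OF int]
    by (simp add: complex_eq_iff Re_exp Im_exp)
  finally show ?thesis .
qed

lemma measure_weighted_distr:
  fixes h X :: "'a \<Rightarrow> real"
  assumes "prob_space M" and [measurable]: "h \<in> borel_measurable M" "X \<in> borel_measurable M" "B \<in> sets borel"
    and h: "\<And>x. 0 \<le> h x" "\<And>x. h x \<le> C"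
  shows "measure (distr (density M (\<lambda>x. ennreal (h x))) borel X) B = (\<integral>x. h x * indicator B (X x) \<partial>M)"
proof -
  interpret prob_space M by fact
  have C: "norm (h x) \<le> C" for x using h(1)[of x] h(2)[of x] by auto
  have [simp]: "integrable M (\<lambda>x. h x * indicator B (X x))"
    by (rule integrable_const_bound[where B=C])
      (use C order_trans[OF h] in \<open>auto simp: abs_mult indicator_def\<close>)
  have "emeasure (distr (density M (\<lambda>x. ennreal (h x))) borel X) B
      = (\<integral>\<^sup>+x. ennreal (h x * indicator B (X x)) \<partial>M)"
    by (subst emeasure_distr, simp, simp, subst emeasure_density)
      (auto intro!: nn_integral_cong simp: indicator_def)
  also have "\<dots> = ennreal (\<integral>x. h x * indicator B (X x) \<partial>M)"
    by (rule nn_integral_eq_integral) (auto simp: h)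
  finally show ?thesis by (simp add: measure_def h)
qed

text \<open>Levy's theorem compares probability laws, hence both weighted laws are divided by their
  common mass \<open>m\<close>, which the hypothesis yields at frequency and phase 0. The phases 0
  and -pi/2 recover the real and imaginary parts of the characteristic functions. If
  \<open>m\<close> is 0, both weights vanish almost everywhere.\<close>

lemma weighted_char_unique:
  fixes h X :: "'a \<Rightarrow> real" and h' X' :: "'b \<Rightarrow> real"
  assumes M: "prob_space M" and N: "prob_space N"
    and [measurable]: "h \<in> borel_measurable M" "X \<in> borel_measurable M"
      "h' \<in> borel_measurable N" "X' \<in> borel_measurable N"
    and h: "\<And>x. 0 \<le> h x" "\<And>x. h x \<le> C" "\<And>x. 0 \<le> h' x" "\<And>x. h' x \<le> C"
    and eq: "\<And>s \<phi>. (\<integral>x. h x * cos (s * X x + \<phi>) \<partial>M) = (\<integral>x. h' x * cos (s * X' x + \<phi>) \<partial>N)"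
    and [measurable]: "B \<in> sets borel"
  shows "(\<integral>x. h x * indicator B (X x) \<partial>M) = (\<integral>x. h' x * indicator B (X' x) \<partial>N)"
proof -
  interpret M: prob_space M by fact
  interpret N: prob_space N by fact
  have C: "norm (h x) \<le> C" for x using h(1)[of x] h(2)[of x] by auto
  have C': "norm (h' x) \<le> C" for x using h(3)[of x] h(4)[of x] by auto
  have int: "integrable M h" "integrable N h'"
    by (rule M.integrable_const_bound[where B=C] N.integrable_const_bound[where B=C], use C C' in auto)+
  define m where "m = (\<integral>x. h x \<partial>M)"
  have m': "m = (\<integral>x. h' x \<partial>N)" using eq[of 0 0] by (simp add: m_def)
  have m0: "m \<ge> 0" unfolding m_def by (simp add: h)
  define D where "D = distr (density M (\<lambda>x. ennreal (h x / m))) borel X"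
  define D' where "D' = distr (density N (\<lambda>x. ennreal (h' x / m))) borel X'"
  show ?thesis
  proof (cases "m = 0")
    case True
    have "AE x in M. h x = 0" "AE x in N. h' x = 0"
      using True m' int h integral_nonneg_eq_0_iff_AE[OF int(1)] integral_nonneg_eq_0_iff_AE[OF int(2)]
      by (simp_all add: m_def)
    then have "(\<integral>x. h x * indicator B (X x) \<partial>M) = 0" "(\<integral>x. h' x * indicator B (X' x) \<partial>N) = 0"
      by (auto intro!: integral_eq_zero_AE)
    then show ?thesis by simp
  next
    case False
    with m0 have m: "m > 0" by simp
    have im: "integrable M (\<lambda>x. h x / m)" "integrable N (\<lambda>x. h' x / m)" using int by simp_all
    have DM: "prob_space (density M (\<lambda>x. ennreal (h x / m)))"
      using False by (intro prob_spaceI)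
        (simp add: emeasure_density nn_integral_eq_integral[OF im(1)] h m0 flip: m_def)
    have DN: "prob_space (density N (\<lambda>x. ennreal (h' x / m)))"
      using False by (intro prob_spaceI)
        (simp add: emeasure_density nn_integral_eq_integral[OF im(2)] h m0 flip: m')
    have rD: "real_distribution D" unfolding D_def
      by (rule prob_space.real_distribution_distr[OF DM]) simp
    have rD': "real_distribution D'" unfolding D'_def
      by (rule prob_space.real_distribution_distr[OF DN]) simp
    have eqs: "(\<integral>x. h x * sin (s * X x) \<partial>M) = (\<integral>x. h' x * sin (s * X' x) \<partial>N)" for s
      using eq[of s "- pi/2"] by (simp add: cos_diff)
    have "char D s = char D' s" for s
      unfolding D_def D'_def
      using eq[of s 0] eqs[of s] m
      by (subst (1 2) char_weighted_distr[where C="C/m"])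
        (auto simp: M N h divide_right_mono)
    then have "D = D'" by (intro Levy_uniqueness rD rD') auto
    then have "measure D B = measure D' B" by simp
    moreover have "measure D B = (\<integral>x. h x * indicator B (X x) \<partial>M) / m"
      using m unfolding D_def
      by (subst measure_weighted_distr[where C="C/m"]) (auto simp: M h divide_right_mono)
    moreover have "measure D' B = (\<integral>x. h' x * indicator B (X' x) \<partial>N) / m"
      using m unfolding D'_def
      by (subst measure_weighted_distr[where C="C/m"]) (auto simp: N h divide_right_mono)
    ultimately show ?thesis using m by simp
  qed
qed

lemma PiM_measure_eqI_char:
  assumes M: "prob_space M" and N: "prob_space N" and "finite I"
    and sM: "sets M = sets (PiM I (\<lambda>_. borel :: real measure))"
    and sN: "sets N = sets (PiM I (\<lambda>_. borel :: real measure))"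
    and eq: "\<And>t. (CLINT x|M. iexp (\<Sum>i\<in>I. t i * x i)) = (CLINT x|N. iexp (\<Sum>i\<in>I. t i * x i))"
  shows "M = N"
proof -
  interpret M: prob_space M by fact
  interpret N: prob_space N by fact
  have [measurable]: "(\<lambda>x. x i) \<in> borel_measurable M" "(\<lambda>x. x i) \<in> borel_measurable N" if "i \<in> I" for i
    using that by (simp_all add: measurable_cong_sets[OF sM refl] measurable_cong_sets[OF sN refl])
  define w where "w K B x = (\<Prod>i\<in>K. indicator (B i) (x i) :: real)" for K :: "'a set" and B :: "'a \<Rightarrow> real set" and x
  have w01: "0 \<le> w K B x" "w K B x \<le> 1" for K B x
    unfolding w_def by (auto intro!: prod_nonneg prod_le_1)
  define \<theta> where "\<theta> K t x = (\<Sum>i\<in>I-K. t i * x i)" for K and t x :: "'a \<Rightarrow> real"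
  \<comment> \<open>The coordinates in K are tested by Borel sets, the others by a character. Moving a coordinate k
    from the second group to the first is the one-dimensional uniqueness theorem for the law of that
    coordinate under the nonnegative weight w (1 + cos (...)).\<close>
  have main: "(\<integral>x. w K B x * cos (\<theta> K t x + \<phi>) \<partial>M) = (\<integral>x. w K B x * cos (\<theta> K t x + \<phi>) \<partial>N)"
    if "K \<subseteq> I" "\<And>i. B i \<in> sets borel" for K B t \<phi>
    using finite_subset[OF that(1) \<open>finite I\<close>] that
  proof (induction K arbitrary: t \<phi> rule: finite_induct)
    case empty
    have *: "(\<integral>x. cos ((\<Sum>i\<in>I. t i * x i) + \<phi>) \<partial>Q) =
      Re (cis \<phi> * (CLINT x|Q. iexp (\<Sum>i\<in>I. t i * x i)))"
      if "prob_space Q" "sets Q = sets (PiM I (\<lambda>_. borel :: real measure))" for Q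
    proof -
      interpret Q: prob_space Q by fact
      have [measurable]: "(\<lambda>x. x i) \<in> borel_measurable Q" if "i \<in> I" for i
        using that by (simp_all add: measurable_cong_sets[OF \<open>sets Q = _\<close> refl])
      have int: "integrable Q (\<lambda>x. cis \<phi> * iexp (\<Sum>i\<in>I. t i * x i))"
        by (intro integrable_mult_right Q.integrable_iexp) auto
      show ?thesis
        using integral_Re[OF int] by (simp add: Re_exp Im_exp cos_add mult_ac)
    qed
    show ?case
      using *[OF M sM] *[OF N sN] eq[of t] by (simp add: w_def \<theta>_def)
  next
    case (insert k K)
    then have k: "k \<in> I" "K \<subseteq> I" "k \<notin> K" by auto
    note IH = insert.IH[OF k(2) insert.prems(2)]
    have [measurable]: "w K B \<in> borel_measurable M" "w K B \<in> borel_measurable N"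
      using k(2) insert.prems(2) unfolding w_def by (auto intro!: borel_measurable_prod)
    have [measurable]: "\<theta> L t \<in> borel_measurable M" "\<theta> L t \<in> borel_measurable N" for L t
      unfolding \<theta>_def by auto
    define h where "h t \<phi> x = w K B x * (1 + cos (\<theta> (insert k K) t x + \<phi>))" for t \<phi> x
    have h: "0 \<le> h t \<phi> x" "h t \<phi> x \<le> 2" for t \<phi> x
    proof -
      have "0 \<le> 1 + cos (\<theta> (insert k K) t x + \<phi>)" "1 + cos (\<theta> (insert k K) t x + \<phi>) \<le> 2"
        using cos_ge_minus_one[of "\<theta> (insert k K) t x + \<phi>"] cos_le_one[of "\<theta> (insert k K) t x + \<phi>"] by linarith+
      then show "0 \<le> h t \<phi> x" "h t \<phi> x \<le> 2" using w01[of K B x] unfolding h_def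
        using mult_mono[of "w K B x" 1 "1 + cos (\<theta> (insert k K) t x + \<phi>)" 2] by auto
    qed
    have [measurable]: "h t \<phi> \<in> borel_measurable M" "h t \<phi> \<in> borel_measurable N" for t \<phi>
      unfolding h_def by auto
    have \<theta>K: "\<theta> K (t(k := s)) x = s * x k + \<theta> (insert k K) t x" for t s x
    proof -
      have "I - K = insert k (I - insert k K)" using k by auto
      then have "\<theta> K (t(k := s)) x = (\<Sum>i\<in>insert k (I - insert k K). (t(k := s)) i * x i)"
        unfolding \<theta>_def by (rule arg_cong)
      also have "\<dots> = s * x k + (\<Sum>i\<in>I - insert k K. (t(k := s)) i * x i)"
        using \<open>finite I\<close> by (subst sum.insert) auto
      also have "(\<Sum>i\<in>I - insert k K. (t(k := s)) i * x i) = \<theta> (insert k K) t x"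
        unfolding \<theta>_def by (rule sum.cong) auto
      finally show ?thesis .
    qed
    \<comment> \<open>The product formula for cosines reduces \<open>h\<close> times a cosine of
      coordinate \<open>k\<close> to three integrands of the induction hypothesis, in which
      \<open>k\<close> is still tested by a character, of frequency \<open>s\<close> or
      \<open>- s\<close>.\<close>
    have hcos: "h t \<phi> x * cos (s * x k + \<psi>) = w K B x * cos (\<theta> K ((\<lambda>_. 0)(k := s)) x + \<psi>)
      + (w K B x * cos (\<theta> K (t(k := s)) x + (\<phi> + \<psi>)) / 2
      + w K B x * cos (\<theta> K (t(k := - s)) x + (\<phi> - \<psi>)) / 2)" for t \<phi> s \<psi> x
    proof -
      have "\<theta> (insert k K) (\<lambda>_. 0) x = 0" by (simp add: \<theta>_def)
      moreover have "cos a * cos b = cos (b + a) / 2 + cos (a - b) / 2" for a b :: real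
        by (simp add: cos_add cos_diff field_simps)
      from this[of "\<theta> (insert k K) t x + \<phi>" "s * x k + \<psi>"]
      have "cos (\<theta> (insert k K) t x + \<phi>) * cos (s * x k + \<psi>) =
         cos (\<theta> K (t(k := s)) x + (\<phi> + \<psi>)) / 2 + cos (\<theta> K (t(k := - s)) x + (\<phi> - \<psi>)) / 2"
        unfolding \<theta>K by (simp add: algebra_simps)
      moreover have "h t \<phi> x * cos (s * x k + \<psi>) = w K B x * cos (s * x k + \<psi>)
          + w K B x * (cos (\<theta> (insert k K) t x + \<phi>) * cos (s * x k + \<psi>))"
        by (simp add: h_def algebra_simps)
      ultimately show ?thesis by (simp add: \<theta>K distrib_left)
    qed
    have wcos: "integrable M (\<lambda>x. w K B x * cos (\<theta> L t x + \<phi>))" "integrable N (\<lambda>x. w K B x * cos (\<theta> L t x + \<phi>))" for L t \<phi>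
      by (rule M.integrable_const_bound[where B=1] N.integrable_const_bound[where B=1], use w01 in \<open>auto simp: abs_mult intro!: mult_le_one\<close>)+
    have eqh: "(\<integral>x. h t \<phi> x * indicator (B k) (x k) \<partial>M) = (\<integral>x. h t \<phi> x * indicator (B k) (x k) \<partial>N)" for t \<phi>
    proof (rule weighted_char_unique[OF M N _ _ _ _ h h])
      show "(\<integral>x. h t \<phi> x * cos (s * x k + \<psi>) \<partial>M) = (\<integral>x. h t \<phi> x * cos (s * x k + \<psi>) \<partial>N)" for s \<psi>
        unfolding hcos by (simp add: wcos IH fun_upd_def)
    qed (use k insert.prems in auto)
    have wi: "w (insert k K) B x = w K B x * indicator (B k) (x k)" for x
      using k insert.hyps by (simp add: w_def)
    have split: "h t \<phi> x * indicator (B k) (x k) = w K B x * indicator (B k) (x k) + w (insert k K) B x * cos (\<theta> (insert k K) t x + \<phi>)"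
       for t \<phi> x unfolding h_def wi by (simp add: algebra_simps)
    \<comment> \<open>At frequency and phase 0 the weight is \<open>2 * w\<close>. This instance
      isolates the summand coming from the 1 in \<open>1 + cos\<close>, which can then be
      subtracted.\<close>
    have split0: "h (\<lambda>_. 0) 0 x * indicator (B k) (x k) = 2 * (w K B x * indicator (B k) (x k))" for x
      unfolding h_def by (simp add: \<theta>_def)
    have [measurable]: "(\<lambda>x. x k) \<in> borel_measurable M" "(\<lambda>x. x k) \<in> borel_measurable N" "B k \<in> sets borel"
      using k insert.prems by auto
    have i: "integrable M (\<lambda>x. w K B x * indicator (B k) (x k))" "integrable N (\<lambda>x. w K B x * indicator (B k) (x k))"
      by (rule M.integrable_const_bound[where B=1] N.integrable_const_bound[where B=1], use w01 in \<open>auto simp: abs_mult intro!: mult_le_one\<close>)+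
    have i': "integrable M (\<lambda>x. w (insert k K) B x * cos (\<theta> (insert k K) t x + \<phi>))"
        "integrable N (\<lambda>x. w (insert k K) B x * cos (\<theta> (insert k K) t x + \<phi>))"
      unfolding wi by (rule M.integrable_const_bound[where B=1] N.integrable_const_bound[where B=1], use w01 in \<open>auto simp: abs_mult intro!: mult_le_one\<close>)+
    show ?case
      using eqh[of t \<phi>] eqh[of "\<lambda>_. 0" 0] unfolding split0 unfolding split
      by (simp add: i i')
  qed
  show ?thesis
  proof (rule measure_eqI_PiM_infinite[OF sM sN])
    fix A J assume J: "finite J" "J \<subseteq> I" "\<And>i. i \<in> J \<Longrightarrow> A i \<in> sets (borel :: real measure)"
    \<comment> \<open>\<open>w J B\<close> reads \<open>B\<close> only on \<open>J\<close>; the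
      value \<open>UNIV\<close> elsewhere makes every \<open>B i\<close> Borel, as
      \<open>main\<close> demands.\<close>
    define B where "B i = (if i \<in> J then A i else UNIV)" for i
    have B: "B i \<in> sets borel" for i using J by (auto simp: B_def)
    have *: "emeasure Q (prod_emb I (\<lambda>_. borel) J (Pi\<^sub>E J A)) = ennreal (\<integral>x. w J B x \<partial>Q)"
      if Q: "prob_space Q" "sets Q = sets (PiM I (\<lambda>_. borel :: real measure))" for Q
    proof -
      interpret Q: prob_space Q by fact
      have sp: "space Q = PiE I (\<lambda>_. UNIV)" using sets_eq_imp_space_eq[OF Q(2)] by (simp add: space_PiM)
      have S: "prod_emb I (\<lambda>_. borel) J (Pi\<^sub>E J A) \<in> sets Q" unfolding Q(2)
        using J by (intro measurable_prod_emb sets_PiM_I_finite) auto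
      have "(\<integral>x. w J B x \<partial>Q) = (\<integral>x. indicator (prod_emb I (\<lambda>_. borel) J (Pi\<^sub>E J A)) x \<partial>Q)"
      proof (rule Bochner_Integration.integral_cong[OF refl])
        fix x assume "x \<in> space Q"
        then have "x \<in> prod_emb I (\<lambda>_. borel) J (Pi\<^sub>E J A) \<longleftrightarrow> (\<forall>i\<in>J. x i \<in> A i)"
          unfolding sp using J(2) by (auto simp: prod_emb_def PiE_iff extensional_def)
        then show "w J B x = indicator (prod_emb I (\<lambda>_. borel) J (Pi\<^sub>E J A)) x"
          using J(1) by (auto simp: w_def B_def indicator_def)
      qed
      also have "\<dots> = measure Q (prod_emb I (\<lambda>_. borel) J (Pi\<^sub>E J A))"
        using S by simp
      finally show ?thesis by (simp add: Q.emeasure_eq_measure)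
    qed
    have "(\<integral>x. w J B x \<partial>M) = (\<integral>x. w J B x \<partial>N)"
      using main[of J B "\<lambda>_. 0" 0, OF J(2) B] by (simp add: \<theta>_def)
    then show "emeasure M (prod_emb I (\<lambda>_. borel) J (Pi\<^sub>E J A)) = emeasure N (prod_emb I (\<lambda>_. borel) J (Pi\<^sub>E J A))"
      by (simp add: * M N sM sN)
  qed unfold_locales
qed

subsection \<open>Centred Gaussian laws\<close>

lemma prob_space_std_normal: "prob_space std_normal_distribution"
  by (rule prob_space_normal_density) simp

lemma sets_Rp: "sets (Rp p) = sets (PiM {..<p} (\<lambda>_. borel))"
  unfolding Rp_def by (rule sets_PiM_cong) auto

lemma sets_PiM_std_normal:
  "sets (PiM I (\<lambda>_. std_normal_distribution)) = sets (PiM I (\<lambda>_. borel))"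
  by (rule sets_PiM_cong) auto

lemma prob_space_PiM_std_normal: "prob_space (PiM I (\<lambda>_. std_normal_distribution))"
  by (intro prob_space_PiM prob_space_std_normal)

lemma char_PiM_std_normal:
  assumes "finite J"
  shows "(CLINT z|PiM J (\<lambda>_. std_normal_distribution). iexp (\<Sum>j\<in>J. c j * z j)) =
    complex_of_real (exp (- (\<Sum>j\<in>J. (c j)\<^sup>2) / 2))"
proof -
  interpret N: prob_space std_normal_distribution by (rule prob_space_std_normal)
  interpret P: product_sigma_finite "\<lambda>_. std_normal_distribution" by standard
  have "(CLINT z|PiM J (\<lambda>_. std_normal_distribution). iexp (\<Sum>j\<in>J. c j * z j)) =
     (CLINT z|PiM J (\<lambda>_. std_normal_distribution). (\<Prod>j\<in>J. iexp (c j * z j)))"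
    using assms by (simp add: sum_distrib_left exp_sum)
  also have "\<dots> = (\<Prod>j\<in>J. (CLINT x|std_normal_distribution. iexp (c j * x)))"
    by (intro P.product_integral_prod assms N.integrable_iexp) auto
  also have "\<dots> = (\<Prod>j\<in>J. complex_of_real (exp (- (c j)\<^sup>2 / 2)))"
    using fun_cong[OF char_std_normal_distribution] by (simp add: char_def)
  also have "\<dots> = complex_of_real (exp (- (\<Sum>j\<in>J. (c j)\<^sup>2) / 2))"
    using assms by (simp add: exp_sum sum_divide_distrib flip: sum_negf of_real_prod)
  finally show ?thesis .
qed

text \<open>The source index set is arbitrary, so that a law can be driven by p Gaussians, by p + 1
  (a spike with its extra scalar) or by a single one (a rank-one covariance).\<close>

definition linear_image :: "nat \<Rightarrow> 'a set \<Rightarrow> (nat \<Rightarrow> 'a \<Rightarrow> real) \<Rightarrow> ('a \<Rightarrow> real) \<Rightarrow> nat \<Rightarrow> real" where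
  "linear_image p J B z = (\<lambda>i\<in>{..<p}. \<Sum>j\<in>J. B i j * z j)"

lemma measurable_linear_image:
  "linear_image p J B \<in> measurable (PiM J (\<lambda>_. borel)) (PiM {..<p} (\<lambda>_. borel))"
  unfolding linear_image_def by measurable

lemma measurable_linear_image' [measurable]:
  "linear_image p J B \<in> measurable (PiM J (\<lambda>_. std_normal_distribution)) (Rp p)"
  using measurable_linear_image by (simp add: measurable_cong_sets[OF sets_PiM_std_normal sets_Rp])

lemma char_linear_image:
  assumes "finite J"
  shows "(CLINT x|distr (PiM J (\<lambda>_. std_normal_distribution)) (Rp p) (linear_image p J B).
      iexp (\<Sum>i<p. t i * x i)) =
    complex_of_real (exp (- (\<Sum>i<p. \<Sum>l<p. t i * t l * (\<Sum>j\<in>J. B i j * B l j)) / 2))"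
proof -
  have [measurable]: "(\<lambda>x. iexp (\<Sum>i<p. t i * x i)) \<in> borel_measurable (Rp p)"
    by (simp add: measurable_cong_sets[OF sets_Rp refl])
  have "(CLINT x|distr (PiM J (\<lambda>_. std_normal_distribution)) (Rp p) (linear_image p J B).
      iexp (\<Sum>i<p. t i * x i)) =
      (CLINT z|PiM J (\<lambda>_. std_normal_distribution). iexp (\<Sum>i<p. t i * linear_image p J B z i))"
    by (rule integral_distr) measurable
  moreover have "(\<Sum>i<p. t i * linear_image p J B z i) = (\<Sum>j\<in>J. (\<Sum>i<p. t i * B i j) * z j)" for z
    unfolding linear_image_def
    by (simp add: sum_distrib_left sum_distrib_right mult.assoc) (rule sum.swap)
  moreover have "(\<Sum>j\<in>J. (\<Sum>i<p. t i * B i j)\<^sup>2) = (\<Sum>i<p. \<Sum>l<p. t i * t l * (\<Sum>j\<in>J. B i j * B l j))"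
  proof -
    have "(\<Sum>j\<in>J. (\<Sum>i<p. t i * B i j)\<^sup>2) = (\<Sum>j\<in>J. \<Sum>i<p. \<Sum>l<p. t i * B i j * (t l * B l j))"
      by (simp add: power2_eq_square sum_product)
    also have "\<dots> = (\<Sum>i<p. \<Sum>l<p. \<Sum>j\<in>J. t i * B i j * (t l * B l j))"
      by (subst sum.swap, rule sum.cong[OF refl], rule sum.swap)
    finally show ?thesis by (simp add: sum_distrib_left mult_ac)
  qed
  ultimately show ?thesis
    by (simp only: char_PiM_std_normal[OF assms])
qed

text \<open>The square factor \<open>A\<close> ensures that the choice in \<open>psd_factor\<close>
  is a genuine factorisation of \<open>S\<close>. Any factor \<open>B\<close> then gives the same
  law, as the characteristic function sees a factor only through the covariance.\<close>

lemma gaussian_eq_linear_image: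
  assumes J: "finite J"
    and A: "\<And>i l. i < p \<Longrightarrow> l < p \<Longrightarrow> S i l = (\<Sum>j<p. A i j * A l j)"
    and B: "\<And>i l. i < p \<Longrightarrow> l < p \<Longrightarrow> S i l = (\<Sum>j\<in>J. B i j * B l j)"
  shows "gaussian p S = distr (PiM J (\<lambda>_. std_normal_distribution)) (Rp p) (linear_image p J B)"
proof -
  have F: "\<forall>i<p. \<forall>j<p. S i j = (\<Sum>l<p. psd_factor p S i l * psd_factor p S j l)"
    unfolding psd_factor_def by (rule someI[of _ A]) (use A in auto)
  have "gaussian p S = distr (PiM {..<p} (\<lambda>_. std_normal_distribution)) (Rp p) (linear_image p {..<p} (psd_factor p S))"
    unfolding gaussian_def linear_image_def ..
  also have "\<dots> = distr (PiM J (\<lambda>_. std_normal_distribution)) (Rp p) (linear_image p J B)"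
  proof (rule PiM_measure_eqI_char)
    fix t :: "nat \<Rightarrow> real"
    have "(\<Sum>i<p. \<Sum>l<p. t i * t l * (\<Sum>j<p. psd_factor p S i j * psd_factor p S l j)) =
       (\<Sum>i<p. \<Sum>l<p. t i * t l * (\<Sum>j\<in>J. B i j * B l j))"
      using F B by (intro sum.cong refl) auto
    then show "(CLINT x|distr (PiM {..<p} (\<lambda>_. std_normal_distribution)) (Rp p) (linear_image p {..<p} (psd_factor p S)). iexp (\<Sum>i<p. t i * x i))
      = (CLINT x|distr (PiM J (\<lambda>_. std_normal_distribution)) (Rp p) (linear_image p J B). iexp (\<Sum>i<p. t i * x i))"
      by (simp only: char_linear_image J finite_lessThan)
  qed (auto simp: sets_Rp intro!: prob_space.prob_space_distr prob_space_PiM_std_normal)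
  finally show ?thesis .
qed

lemma prob_space_gaussian: "prob_space (gaussian p S)"
proof -
  have "gaussian p S = distr (PiM {..<p} (\<lambda>_. std_normal_distribution)) (Rp p) (linear_image p {..<p} (psd_factor p S))"
    unfolding gaussian_def linear_image_def ..
  then show ?thesis by (auto intro!: prob_space.prob_space_distr prob_space_PiM_std_normal)
qed

lemma sets_gaussian [simp]: "sets (gaussian p S) = sets (Rp p)"
  by (simp add: gaussian_def)

section \<open>Exponential tilting of the scalar standard normal\<close>

lemma std_normal_density_shift:
  "std_normal_density (x - a) = std_normal_density x * exp (a * x - a\<^sup>2 / 2)"
  by (simp add: std_normal_density_def field_simps power2_eq_square flip: exp_add)

text \<open>The Cameron-Martin formula in dimension one, by translating Lebesgue measure.\<close>

lemma nn_integral_std_normal_shift: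
  assumes [measurable]: "h \<in> borel_measurable borel"
  shows "(\<integral>\<^sup>+x. h (x + a) \<partial>std_normal_distribution) =
    (\<integral>\<^sup>+x. ennreal (exp (a * x - a\<^sup>2 / 2)) * h x \<partial>std_normal_distribution)"
proof -
  have "(\<integral>\<^sup>+x. h (x + a) \<partial>std_normal_distribution) = (\<integral>\<^sup>+x. ennreal (std_normal_density x) * h (x + a) \<partial>lborel)"
    by (subst nn_integral_density) auto
  also have "\<dots> = (\<integral>\<^sup>+x. ennreal (std_normal_density (x + a - a)) * h (x + a) \<partial>lborel)"
    by simp
  also have "\<dots> = (\<integral>\<^sup>+x. ennreal (std_normal_density (x - a)) * h x \<partial>lborel)"
    using nn_integral_real_affine[where c=1 and t=a and f="\<lambda>x. ennreal (std_normal_density (x - a)) * h x"]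
    by (simp add: add.commute)
  also have "\<dots> = (\<integral>\<^sup>+x. ennreal (exp (a * x - a\<^sup>2 / 2)) * h x \<partial>std_normal_distribution)"
    unfolding std_normal_density_shift
    by (subst nn_integral_density) (auto simp: ennreal_mult mult.assoc)
  finally show ?thesis .
qed

text \<open>Completing the square: up to the constant exp (a^2 / 2), the integrand is the density of
  the translate by a, whose mass is 1.\<close>

lemma nn_integral_std_normal_exp:
  "(\<integral>\<^sup>+x. ennreal (exp (a * x)) \<partial>std_normal_distribution) = ennreal (exp (a\<^sup>2 / 2))"
proof -
  interpret N: prob_space std_normal_distribution by (rule prob_space_std_normal)
  have "(\<integral>\<^sup>+x. ennreal (exp (a * x)) \<partial>std_normal_distribution) =
    (\<integral>\<^sup>+x. ennreal (exp (a\<^sup>2 / 2)) * ennreal (exp (a * x - a\<^sup>2 / 2)) \<partial>std_normal_distribution)"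
    by (intro nn_integral_cong) (simp flip: exp_add ennreal_mult)
  also have "\<dots> = ennreal (exp (a\<^sup>2 / 2)) * (\<integral>\<^sup>+x. ennreal (exp (a * x - a\<^sup>2 / 2)) * 1 \<partial>std_normal_distribution)"
    by (subst nn_integral_cmult) auto
  also have "(\<integral>\<^sup>+x. ennreal (exp (a * x - a\<^sup>2 / 2)) * 1 \<partial>std_normal_distribution) = 1"
    unfolding nn_integral_std_normal_shift[of "\<lambda>_. 1", symmetric, OF borel_measurable_const] using N.emeasure_space_1 by simp
  finally show ?thesis by simp
qed

lemma nn_integral_std_normal_exp_square:
  assumes "b < 1"
  shows "(\<integral>\<^sup>+x. ennreal (exp (b * x\<^sup>2 / 2)) \<partial>std_normal_distribution) = ennreal (1 / sqrt (1 - b))"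
proof -
  \<comment> \<open>The factor exp (b x^2 / 2) lowers the precision from 1 to 1 - b. The new
    standard deviation \<open>s\<close> is also the quotient of the two normalising constants, hence
    the value of the integral.\<close>
  define s where "s = 1 / sqrt (1 - b)"
  have s: "s > 0" using assms by (simp add: s_def)
  have s2: "s\<^sup>2 = 1 / (1 - b)" using assms by (simp add: s_def power_divide)
  have sqs: "sqrt (2 * pi * s\<^sup>2) = s * sqrt (2 * pi)"
    using s by (simp add: real_sqrt_mult)
  have *: "std_normal_density x * exp (b * x\<^sup>2 / 2) = s * normal_density 0 s x" for x
  proof -
    have "s * normal_density 0 s x = (1 / sqrt (2 * pi)) * exp (- (x\<^sup>2 * (1 - b)) / 2)"
      using s assms unfolding normal_density_def sqs by (simp add: s2 field_simps)
    also have "exp (- (x\<^sup>2 * (1 - b)) / 2) = exp (- x\<^sup>2 / 2) * exp (b * x\<^sup>2 / 2)"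
      by (simp add: field_simps flip: exp_add)
    finally show ?thesis by (simp add: std_normal_density_def)
  qed
  have "(\<integral>\<^sup>+x. ennreal (exp (b * x\<^sup>2 / 2)) \<partial>std_normal_distribution) =
    (\<integral>\<^sup>+x. ennreal (s * normal_density 0 s x) \<partial>lborel)"
    by (subst nn_integral_density) (auto simp flip: * ennreal_mult)
  also have "\<dots> = ennreal s"
    using s by (simp add: ennreal_mult nn_integral_cmult nn_integral_eq_integral)
  finally show ?thesis by (simp add: s_def)
qed

subsection \<open>Likelihood ratio of a spiked Gaussian\<close>

text \<open>This turns the likelihood ratio of one observation into that of the sample; on
  rectangles both sides are the same product of integrals.\<close>

lemma PiM_density:
  assumes "finite I" "prob_space M" and [measurable]: "f \<in> borel_measurable M" and D: "prob_space (density M f)"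
  shows "PiM I (\<lambda>_. density M f) = density (PiM I (\<lambda>_. M)) (\<lambda>x. \<Prod>i\<in>I. f (x i))"
proof (rule sym)
  interpret M: prob_space M by fact
  interpret D: prob_space "density M f" by fact
  interpret PM: product_sigma_finite "\<lambda>_. M" by standard
  interpret PD: product_sigma_finite "\<lambda>_. density M f" by standard
  show "density (PiM I (\<lambda>_. M)) (\<lambda>x. \<Prod>i\<in>I. f (x i)) = PiM I (\<lambda>_. density M f)"
  proof (rule PD.PiM_eqI)
    fix A assume "\<And>i. i \<in> I \<Longrightarrow> A i \<in> sets (density M f)"
    then have A: "\<And>i. i \<in> I \<Longrightarrow> A i \<in> sets M" by simp
    have "emeasure (density (PiM I (\<lambda>_. M)) (\<lambda>x. \<Prod>i\<in>I. f (x i))) (PiE I A)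
        = (\<integral>\<^sup>+x. (\<Prod>i\<in>I. f (x i)) * indicator (PiE I A) x \<partial>PiM I (\<lambda>_. M))"
      using A assms(1) by (subst emeasure_density) (auto intro!: sets_PiM_I_finite)
    also have "\<dots> = (\<integral>\<^sup>+x. (\<Prod>i\<in>I. f (x i) * indicator (A i) (x i)) \<partial>PiM I (\<lambda>_. M))"
    proof (rule nn_integral_cong)
      fix x assume "x \<in> space (PiM I (\<lambda>_. M))"
      then have "indicator (PiE I A) x = (\<Prod>i\<in>I. indicator (A i) (x i) :: ennreal)"
        using assms(1) by (auto simp: indicator_def space_PiM PiE_iff)
      then show "(\<Prod>i\<in>I. f (x i)) * indicator (PiE I A) x = (\<Prod>i\<in>I. f (x i) * indicator (A i) (x i))"
        by (simp add: prod.distrib)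
    qed
    also have "\<dots> = (\<Prod>i\<in>I. \<integral>\<^sup>+x. f x * indicator (A i) x \<partial>M)"
      using A assms(1) by (intro PM.product_nn_integral_prod) auto
    also have "\<dots> = (\<Prod>i\<in>I. emeasure (density M f) (A i))"
      using A by (intro prod.cong refl) (simp add: emeasure_density)
    finally show "emeasure (density (PiM I (\<lambda>_. M)) (\<lambda>x. \<Prod>i\<in>I. f (x i))) (PiE I A)
       = (\<Prod>i\<in>I. emeasure (density M f) (A i))" .
  qed (use assms(1) in \<open>auto intro!: sets_PiM_cong\<close>)
qed

text \<open>The likelihood ratio of N(w, I) with respect to N(0, I).\<close>

definition shift_lr :: "'a set \<Rightarrow> ('a \<Rightarrow> real) \<Rightarrow> ('a \<Rightarrow> real) \<Rightarrow> real" where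
  "shift_lr I w x = exp (\<Sum>i\<in>I. w i * x i - (w i)\<^sup>2 / 2)"

lemma distr_PiM_std_normal_shift:
  assumes "finite I"
  shows "distr (PiM I (\<lambda>_. std_normal_distribution)) (PiM I (\<lambda>_. std_normal_distribution)) (\<lambda>x. \<lambda>i\<in>I. x i + w i)
    = density (PiM I (\<lambda>_. std_normal_distribution)) (\<lambda>x. ennreal (shift_lr I w x))" (is "?L = ?R")
proof (rule measure_eqI_PiM_finite[OF assms])
  interpret N: prob_space std_normal_distribution by (rule prob_space_std_normal)
  interpret P: product_sigma_finite "\<lambda>_. std_normal_distribution" by standard
  have [measurable]: "shift_lr I w \<in> borel_measurable (PiM I (\<lambda>_. std_normal_distribution))"
    unfolding shift_lr_def by measurable
  fix A assume "\<And>i. i \<in> I \<Longrightarrow> A i \<in> sets std_normal_distribution"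
  then have A: "A i \<in> sets borel" if "i \<in> I" for i using that by simp
  have 1: "emeasure std_normal_distribution ((\<lambda>x. x + w i) -` A i) =
       (\<integral>\<^sup>+x. ennreal (exp (w i * x - (w i)\<^sup>2 / 2)) * indicator (A i) x \<partial>std_normal_distribution)"
    if "i \<in> I" for i
  proof -
    have [measurable]: "A i \<in> sets borel" by (rule A[OF that])
    have "(\<lambda>x. x + w i) -` A i \<in> sets borel"
      by (rule measurable_sets_borel[of _ borel]) auto
    then have "emeasure std_normal_distribution ((\<lambda>x. x + w i) -` A i)
        = (\<integral>\<^sup>+x. indicator ((\<lambda>x. x + w i) -` A i) x \<partial>std_normal_distribution)"
      by simp
    also have "\<dots> = (\<integral>\<^sup>+x. indicator (A i) (x + w i) \<partial>std_normal_distribution)"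
      by (intro nn_integral_cong) (auto simp: indicator_def)
    also have "\<dots> = (\<integral>\<^sup>+x. ennreal (exp (w i * x - (w i)\<^sup>2 / 2)) * indicator (A i) x \<partial>std_normal_distribution)"
      by (rule nn_integral_std_normal_shift) measurable
    finally show ?thesis .
  qed
  have S: "PiE I A \<in> sets (PiM I (\<lambda>_. std_normal_distribution))"
    using assms A by (auto intro!: sets_PiM_I_finite)
  have "emeasure ?L (PiE I A) = emeasure (PiM I (\<lambda>_. std_normal_distribution)) (PiE I (\<lambda>i. (\<lambda>x. x + w i) -` A i))"
    using S by (subst emeasure_distr) (auto simp: space_PiM PiE_iff intro!: arg_cong2[where f=emeasure])
  also have "\<dots> = (\<Prod>i\<in>I. emeasure std_normal_distribution ((\<lambda>x. x + w i) -` A i))"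
    using assms A by (intro P.emeasure_PiM) (auto intro!: measurable_sets_borel[of _ borel])
  also have "\<dots> = (\<Prod>i\<in>I. \<integral>\<^sup>+x. ennreal (exp (w i * x - (w i)\<^sup>2 / 2)) * indicator (A i) x \<partial>std_normal_distribution)"
    using 1 by (intro prod.cong) auto
  also have "\<dots> = (\<integral>\<^sup>+x. (\<Prod>i\<in>I. ennreal (exp (w i * x i - (w i)\<^sup>2 / 2)) * indicator (A i) (x i)) \<partial>PiM I (\<lambda>_. std_normal_distribution))"
    using A assms by (intro P.product_nn_integral_prod[symmetric]) auto
  also have "\<dots> = (\<integral>\<^sup>+x. ennreal (shift_lr I w x) * indicator (PiE I A) x \<partial>PiM I (\<lambda>_. std_normal_distribution))"
  proof (rule nn_integral_cong)
    fix x assume "x \<in> space (PiM I (\<lambda>_. std_normal_distribution))"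
    then have "indicator (PiE I A) x = (\<Prod>i\<in>I. indicator (A i) (x i) :: ennreal)"
      using assms by (auto simp: indicator_def space_PiM PiE_iff)
    then show "(\<Prod>i\<in>I. ennreal (exp (w i * x i - (w i)\<^sup>2 / 2)) * indicator (A i) (x i)) = ennreal (shift_lr I w x) * indicator (PiE I A) x"
      using assms by (simp add: shift_lr_def exp_sum prod.distrib prod_ennreal)
  qed
  also have "\<dots> = emeasure ?R (PiE I A)"
    using S by (subst emeasure_density) auto
  finally show "emeasure ?L (PiE I A) = emeasure ?R (PiE I A)" .
next
  interpret P: prob_space "PiM I (\<lambda>_. std_normal_distribution)" by (rule prob_space_PiM_std_normal)
  interpret L: prob_space ?L by (rule P.prob_space_distr) measurable
  show "range (\<lambda>_. PiE I (\<lambda>_. UNIV)) \<subseteq> prod_algebra I (\<lambda>_. std_normal_distribution)"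
    using assms by (auto intro!: prod_algebraI_finite)
  show "emeasure ?L (PiE I (\<lambda>_. UNIV)) \<noteq> \<infinity>" by simp
qed (auto simp: space_PiM)

lemma nn_integral_PiM_std_normal_shift:
  assumes "finite I" and [measurable]: "h \<in> borel_measurable (PiM I (\<lambda>_. borel))"
  shows "(\<integral>\<^sup>+x. h (\<lambda>i\<in>I. x i + w i) \<partial>PiM I (\<lambda>_. std_normal_distribution)) =
    (\<integral>\<^sup>+x. ennreal (shift_lr I w x) * h x \<partial>PiM I (\<lambda>_. std_normal_distribution))"
proof -
  have [measurable]: "h \<in> borel_measurable (PiM I (\<lambda>_. std_normal_distribution))"
    by (simp add: measurable_cong_sets[OF sets_PiM_std_normal refl])
  have [measurable]: "shift_lr I w \<in> borel_measurable (PiM I (\<lambda>_. std_normal_distribution))"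
    unfolding shift_lr_def by measurable
  have "(\<integral>\<^sup>+x. h (\<lambda>i\<in>I. x i + w i) \<partial>PiM I (\<lambda>_. std_normal_distribution)) =
     integral\<^sup>N (distr (PiM I (\<lambda>_. std_normal_distribution)) (PiM I (\<lambda>_. std_normal_distribution)) (\<lambda>x. \<lambda>i\<in>I. x i + w i)) h"
    by (subst nn_integral_distr) auto
  also have "\<dots> = (\<integral>\<^sup>+x. ennreal (shift_lr I w x) * h x \<partial>PiM I (\<lambda>_. std_normal_distribution))"
    unfolding distr_PiM_std_normal_shift[OF assms(1)] by (subst nn_integral_density) auto
  finally show ?thesis .
qed

text \<open>Multiplying the two exponentials adds the shifts and leaves the cross term exp <w, u>;
  the likelihood ratio for the shift w + u has mass 1.\<close>

lemma nn_integral_shift_lr_mult: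
  assumes "finite I"
  shows "(\<integral>\<^sup>+x. ennreal (shift_lr I w x) * ennreal (shift_lr I u x) \<partial>PiM I (\<lambda>_. std_normal_distribution))
    = ennreal (exp (\<Sum>i\<in>I. w i * u i))"
proof -
  interpret P: prob_space "PiM I (\<lambda>_. std_normal_distribution)" by (rule prob_space_PiM_std_normal)
  have [measurable]: "shift_lr I w \<in> borel_measurable (PiM I (\<lambda>_. std_normal_distribution))" for w
    unfolding shift_lr_def by measurable
  have "shift_lr I w x * shift_lr I u x = exp (\<Sum>i\<in>I. w i * u i) * shift_lr I (\<lambda>i. w i + u i) x" for x
    unfolding shift_lr_def
    by (simp add: algebra_simps power2_eq_square add_divide_distrib flip: exp_add sum.distrib)
  then have "(\<integral>\<^sup>+x. ennreal (shift_lr I w x) * ennreal (shift_lr I u x) \<partial>PiM I (\<lambda>_. std_normal_distribution))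
    = (\<integral>\<^sup>+x. ennreal (exp (\<Sum>i\<in>I. w i * u i)) * ennreal (shift_lr I (\<lambda>i. w i + u i) x) \<partial>PiM I (\<lambda>_. std_normal_distribution))"
    by (intro nn_integral_cong) (simp add: shift_lr_def flip: ennreal_mult)
  also have "\<dots> = ennreal (exp (\<Sum>i\<in>I. w i * u i)) * (\<integral>\<^sup>+x. ennreal (shift_lr I (\<lambda>i. w i + u i) x) * 1 \<partial>PiM I (\<lambda>_. std_normal_distribution))"
    by (subst nn_integral_cmult) auto
  also have "(\<integral>\<^sup>+x. ennreal (shift_lr I (\<lambda>i. w i + u i) x) * 1 \<partial>PiM I (\<lambda>_. std_normal_distribution)) = 1"
    by (subst nn_integral_PiM_std_normal_shift[OF assms, symmetric]) (auto simp: P.emeasure_space_1)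
  finally show ?thesis by simp
qed

text \<open>The density of the law of z + c g v with respect to that of z, where z and g are
  independent standard normal.\<close>
definition spike_lr :: "nat \<Rightarrow> real \<Rightarrow> (nat \<Rightarrow> real) \<Rightarrow> (nat \<Rightarrow> real) \<Rightarrow> ennreal" where
  "spike_lr p c v x = (\<integral>\<^sup>+g. ennreal (shift_lr {..<p} (\<lambda>i. c * g * v i) x) \<partial>std_normal_distribution)"

lemma measurable_shift_lr_pair [measurable]:
  "(\<lambda>(x, g). shift_lr {..<p} (\<lambda>i. c * g * v i) x)
     \<in> borel_measurable (PiM {..<p} (\<lambda>_. std_normal_distribution) \<Otimes>\<^sub>M std_normal_distribution)"
  unfolding shift_lr_def split_beta by measurable

lemma measurable_spike_lr:
  "spike_lr p c v \<in> borel_measurable (PiM {..<p} (\<lambda>_. std_normal_distribution))"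
proof -
  interpret N: prob_space std_normal_distribution by (rule prob_space_std_normal)
  show ?thesis unfolding spike_lr_def[abs_def]
    by (rule N.borel_measurable_nn_integral) (simp add: split_beta, measurable)
qed

text \<open>Each factor is an average over its own Gaussian, g or g'. Integrating over the data
  first leaves exp (r g g') with r = c^2 <v, u>; integrating over g' gives exp (r^2 g^2 / 2), whose
  mean is finite for |r| < 1.\<close>

lemma nn_integral_spike_lr_mult:
  assumes "\<bar>c\<^sup>2 * (\<Sum>i<p. v i * u i)\<bar> < 1"
  shows "(\<integral>\<^sup>+x. spike_lr p c v x * spike_lr p c u x \<partial>PiM {..<p} (\<lambda>_. std_normal_distribution))
    = ennreal (1 / sqrt (1 - (c\<^sup>2 * (\<Sum>i<p. v i * u i))\<^sup>2))" (is "?L = _")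
proof -
  let ?Z = "PiM {..<p} (\<lambda>_. std_normal_distribution)" and ?N = std_normal_distribution
  interpret N: prob_space ?N by (rule prob_space_std_normal)
  interpret P: prob_space ?Z by (rule prob_space_PiM_std_normal)
  interpret NP: pair_sigma_finite ?N ?Z ..
  have m [measurable]: "spike_lr p c u \<in> borel_measurable ?Z" for u by (rule measurable_spike_lr)
  have m1 [measurable]: "(\<lambda>x. shift_lr {..<p} w x) \<in> borel_measurable ?Z" for w
    unfolding shift_lr_def by measurable
  have m2: "(\<lambda>(g, x). ennreal (shift_lr {..<p} (\<lambda>i. c * g * v i) x) * F x) \<in> borel_measurable (?N \<Otimes>\<^sub>M ?Z)"
    if [measurable]: "F \<in> borel_measurable ?Z" for F v
    unfolding shift_lr_def by measurable
  have m3: "(\<lambda>g. ennreal (shift_lr {..<p} (\<lambda>i. c * g * v i) x)) \<in> borel_measurable ?N" for x v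
    unfolding shift_lr_def by measurable
  define r where "r = c\<^sup>2 * (\<Sum>i<p. v i * u i)"
  have "?L = (\<integral>\<^sup>+x. \<integral>\<^sup>+g. ennreal (shift_lr {..<p} (\<lambda>i. c * g * v i) x) * spike_lr p c u x \<partial>?N \<partial>?Z)"
    unfolding spike_lr_def[of p c v] by (intro nn_integral_cong nn_integral_multc[symmetric] m3)
  also have "\<dots> = (\<integral>\<^sup>+g. \<integral>\<^sup>+x. ennreal (shift_lr {..<p} (\<lambda>i. c * g * v i) x) * spike_lr p c u x \<partial>?Z \<partial>?N)"
    by (rule NP.Fubini'[OF m2]) measurable
  also have "\<dots> = (\<integral>\<^sup>+g. \<integral>\<^sup>+x. \<integral>\<^sup>+g'. ennreal (shift_lr {..<p} (\<lambda>i. c * g' * u i) x) * ennreal (shift_lr {..<p} (\<lambda>i. c * g * v i) x) \<partial>?N \<partial>?Z \<partial>?N)"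
    unfolding spike_lr_def[of p c u]
    by (intro nn_integral_cong) (subst nn_integral_multc[OF m3], simp add: mult.commute)
  also have "\<dots> = (\<integral>\<^sup>+g. \<integral>\<^sup>+g'. \<integral>\<^sup>+x. ennreal (shift_lr {..<p} (\<lambda>i. c * g' * u i) x) * ennreal (shift_lr {..<p} (\<lambda>i. c * g * v i) x) \<partial>?Z \<partial>?N \<partial>?N)"
    by (intro nn_integral_cong NP.Fubini'[OF m2]) measurable
  also have "\<dots> = (\<integral>\<^sup>+g. \<integral>\<^sup>+g'. ennreal (exp ((r * g) * g')) \<partial>?N \<partial>?N)"
    by (intro nn_integral_cong, subst nn_integral_shift_lr_mult)
      (auto simp: r_def sum_distrib_left sum_distrib_right power2_eq_square mult_ac)
  also have "\<dots> = (\<integral>\<^sup>+g. ennreal (exp (r\<^sup>2 * g\<^sup>2 / 2)) \<partial>?N)"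
    unfolding nn_integral_std_normal_exp by (simp add: power_mult_distrib)
  also have "\<dots> = ennreal (1 / sqrt (1 - r\<^sup>2))"
    using assms abs_square_less_1[of r] by (intro nn_integral_std_normal_exp_square) (simp add: r_def)
  finally show ?thesis by (simp add: r_def)
qed

lemma gaussian_scaled_identity:
  assumes "0 \<le> s"
  shows "gaussian p (\<lambda>i j. if i = j then s\<^sup>2 else 0) =
    distr (PiM {..<p} (\<lambda>_. std_normal_distribution)) (Rp p) (\<lambda>x. \<lambda>i\<in>{..<p}. s * x i)"
proof -
  have *: "(if i = l then s\<^sup>2 else 0) = (\<Sum>j<p. (if i = j then s else 0) * (if l = j then s else 0))"
    if "i < p" "l < p" for i l
    using that by (simp add: power2_eq_square if_distrib[of "\<lambda>a. a * _"] cong: if_cong)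
  have "linear_image p {..<p} (\<lambda>i j. if i = j then s else 0) = (\<lambda>x. \<lambda>i\<in>{..<p}. s * x i)"
    unfolding linear_image_def by (intro ext restrict_ext) (simp add: if_distrib[of "\<lambda>a. a * _"] cong: if_cong)
  then show ?thesis
    by (subst gaussian_eq_linear_image[where J="{..<p}" and A="\<lambda>i j. if i = j then s else 0" and B="\<lambda>i j. if i = j then s else 0"])
      (use * in auto)
qed

lemma gaussian_spike_eq_density:
  assumes s: "0 < s" and v: "(\<Sum>i<p. (v i)\<^sup>2) = 1"
  shows "gaussian p (\<lambda>i j. (if i = j then s\<^sup>2 else 0) + s\<^sup>2 * c\<^sup>2 * v i * v j) =
    density (gaussian p (\<lambda>i j. if i = j then s\<^sup>2 else 0))
      (\<lambda>y. spike_lr p c v (\<lambda>i\<in>{..<p}. y i / s))" (is "gaussian p ?S = _")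
proof -
  let ?Z = "PiM {..<p} (\<lambda>_. std_normal_distribution)" and ?N = std_normal_distribution
  interpret N: prob_space ?N by (rule prob_space_std_normal)
  interpret P: prob_space ?Z by (rule prob_space_PiM_std_normal)
  interpret NP: pair_sigma_finite ?N ?Z ..
  interpret Pr: product_sigma_finite "\<lambda>_. ?N" by standard
  note [measurable] = measurable_spike_lr
  define T where "T = (\<lambda>x. \<lambda>i\<in>{..<p}. s * x i)"
  have T [measurable]: "T \<in> measurable (PiM {..<p} (\<lambda>_. borel)) (Rp p)"
    unfolding T_def measurable_cong_sets[OF refl sets_Rp] by measurable
  have T' [measurable]: "T \<in> measurable ?Z (Rp p)"
    unfolding T_def measurable_cong_sets[OF sets_PiM_std_normal sets_Rp] by measurable
  define a where "a = sqrt (1 + c\<^sup>2) - 1"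
  have a: "2 * a + a\<^sup>2 = c\<^sup>2"
    by (simp add: a_def power2_eq_square algebra_simps)
  \<comment> \<open>The symmetric square root, as (I + a v v^T)^2 = I + (2 a + a^2) v v^T for a unit vector v;
    it only serves to show that a square factor exists.\<close>
  define A where "A i j = s * ((if i = j then 1 else 0) + a * v i * v j)" for i j :: nat
  have A: "?S i l = (\<Sum>j<p. A i j * A l j)" if "i < p" "l < p" for i l
  proof -
    have "(\<Sum>j<p. A i j * A l j) = (\<Sum>j<p. s\<^sup>2 * ((if i = j then (if l = j then 1 else 0) else 0)
        + (if i = j then a * v l * v j else 0) + (if l = j then a * v i * v j else 0) + a\<^sup>2 * v i * v l * (v j)\<^sup>2))"
      by (intro sum.cong refl) (auto simp: A_def power2_eq_square algebra_simps)
    also have "\<dots> = s\<^sup>2 * ((if i = l then 1 else 0) + a * v l * v i + a * v i * v l + a\<^sup>2 * v i * v l * (\<Sum>j<p. (v j)\<^sup>2))"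
      using that by (simp add: sum.distrib sum_distrib_left[symmetric])
    also have "\<dots> = ?S i l"
      unfolding v a[symmetric] by (simp add: algebra_simps)
    finally show ?thesis ..
  qed
  \<comment> \<open>Index \<open>p\<close>, one past the coordinates, belongs to the extra scalar
    Gaussian: its column is s c v, and the other columns form s times the identity.\<close>
  define B where "B i j = (if j = p then s * c * v i else if i = j then s else 0)" for i j :: nat
  have B: "?S i l = (\<Sum>j\<in>insert p {..<p}. B i j * B l j)" if "i < p" "l < p" for i l
  proof -
    have "(\<Sum>j<p. B i j * B l j) = (\<Sum>j<p. if i = j then (if i = l then s\<^sup>2 else 0) else 0)"
      by (intro sum.cong refl) (auto simp: B_def power2_eq_square)
    then show ?thesis
      using that by (simp add: B_def power2_eq_square)
  qed
  have im: "linear_image p (insert p {..<p}) B (x(p := g)) = T (\<lambda>i\<in>{..<p}. x i + c * g * v i)" for x g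
  proof (unfold linear_image_def T_def, rule restrict_ext)
    fix i assume "i \<in> {..<p}"
    moreover have "(\<Sum>j<p. B i j * (x(p := g)) j) = (\<Sum>j<p. if i = j then s * x i else 0)"
      by (intro sum.cong refl) (auto simp: B_def)
    ultimately show "(\<Sum>j\<in>insert p {..<p}. B i j * (x(p := g)) j) = s * (\<lambda>i\<in>{..<p}. x i + c * g * v i) i"
      by (simp add: B_def algebra_simps)
  qed
  have "gaussian p ?S = distr (PiM (insert p {..<p}) (\<lambda>_. ?N)) (Rp p) (linear_image p (insert p {..<p}) B)"
    by (rule gaussian_eq_linear_image[where A=A]) (use A B in auto)
  also have "\<dots> = distr (density ?Z (spike_lr p c v)) (Rp p) T"
  proof (rule measure_eqI)
    fix E assume "E \<in> sets (distr (PiM (insert p {..<p}) (\<lambda>_. ?N)) (Rp p) (linear_image p (insert p {..<p}) B))"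
    then have E [measurable]: "E \<in> sets (Rp p)" by simp
    have h [measurable]: "(\<lambda>x. indicator E (T x) :: ennreal) \<in> borel_measurable (PiM {..<p} (\<lambda>_. borel))"
      by measurable
    have h' [measurable]: "(\<lambda>x. indicator E (T x) :: ennreal) \<in> borel_measurable ?Z"
      by measurable
    have "emeasure (distr (PiM (insert p {..<p}) (\<lambda>_. ?N)) (Rp p) (linear_image p (insert p {..<p}) B)) E
      = (\<integral>\<^sup>+z. indicator E (linear_image p (insert p {..<p}) B z) \<partial>PiM (insert p {..<p}) (\<lambda>_. ?N))"
      by (subst nn_integral_indicator[symmetric], simp, subst nn_integral_distr) auto
    \<comment> \<open>With the extra coordinate integrated last, its value g is frozen, and what
      remains is the standard normal translated by c g v.\<close>
    also have "\<dots> = (\<integral>\<^sup>+g. \<integral>\<^sup>+x. indicator E (T (\<lambda>i\<in>{..<p}. x i + c * g * v i)) \<partial>?Z \<partial>?N)"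
      by (subst Pr.product_nn_integral_insert_rev) (auto simp: im)
    also have "\<dots> = (\<integral>\<^sup>+g. \<integral>\<^sup>+x. ennreal (shift_lr {..<p} (\<lambda>i. c * g * v i) x) * indicator E (T x) \<partial>?Z \<partial>?N)"
      by (intro nn_integral_cong nn_integral_PiM_std_normal_shift h) simp
    also have "\<dots> = (\<integral>\<^sup>+x. \<integral>\<^sup>+g. ennreal (shift_lr {..<p} (\<lambda>i. c * g * v i) x) * indicator E (T x) \<partial>?N \<partial>?Z)"
      by (rule NP.Fubini'[symmetric]) (unfold shift_lr_def, measurable)
    also have "\<dots> = (\<integral>\<^sup>+x. spike_lr p c v x * indicator E (T x) \<partial>?Z)"
      unfolding spike_lr_def
      by (intro nn_integral_cong nn_integral_multc) (unfold shift_lr_def, measurable)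
    also have "\<dots> = (\<integral>\<^sup>+x. indicator E (T x) \<partial>density ?Z (spike_lr p c v))"
      by (subst nn_integral_density) auto
    also have "\<dots> = emeasure (distr (density ?Z (spike_lr p c v)) (Rp p) T) E"
      by (subst nn_integral_indicator[symmetric], simp, subst nn_integral_distr) auto
    finally show "emeasure (distr (PiM (insert p {..<p}) (\<lambda>_. ?N)) (Rp p) (linear_image p (insert p {..<p}) B)) E = \<dots>" .
  qed simp
  also have "\<dots> = density (distr ?Z (Rp p) T) (\<lambda>y. spike_lr p c v (\<lambda>i\<in>{..<p}. y i / s))"
  proof -
    \<comment> \<open>The density moves through the image under \<open>T\<close> once it is
      evaluated at the inverse scaling; the restriction keeps that inverse extensional, so it is a
      true inverse on the product space.\<close>
    have inv: "(\<lambda>i\<in>{..<p}. T x i / s) = x" if "x \<in> space ?Z" for x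
      using that s by (auto simp: T_def space_PiM PiE_iff extensional_def)
    have "(\<lambda>y. \<lambda>i\<in>{..<p}. y i / s) \<in> measurable (Rp p) ?Z"
      unfolding measurable_cong_sets[OF sets_Rp sets_PiM_std_normal] by measurable
    then have "(\<lambda>y. spike_lr p c v (\<lambda>i\<in>{..<p}. y i / s)) \<in> borel_measurable (Rp p)"
      by (rule measurable_compose) measurable
    then show ?thesis
      by (subst density_distr) (auto simp: inv intro!: distr_cong density_cong)
  qed
  also have "distr ?Z (Rp p) T = gaussian p (\<lambda>i j. if i = j then s\<^sup>2 else 0)"
    unfolding T_def using s by (subst gaussian_scaled_identity) auto
  finally show ?thesis .
qed

lemma measurable_spike_lr_scaled:
  "(\<lambda>y. spike_lr p c v (\<lambda>i\<in>{..<p}. y i / s)) \<in> borel_measurable (Rp p)"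
proof -
  have "(\<lambda>y. \<lambda>i\<in>{..<p}. y i / s) \<in> measurable (Rp p) (PiM {..<p} (\<lambda>_. std_normal_distribution))"
    unfolding measurable_cong_sets[OF sets_Rp sets_PiM_std_normal] by measurable
  then show ?thesis
    by (rule measurable_compose) (rule measurable_spike_lr)
qed

lemma nn_integral_spike_lr_scaled_mult:
  assumes "0 < s" "\<bar>c\<^sup>2 * (\<Sum>i<p. v i * u i)\<bar> < 1"
  shows "(\<integral>\<^sup>+y. spike_lr p c v (\<lambda>i\<in>{..<p}. y i / s) * spike_lr p c u (\<lambda>i\<in>{..<p}. y i / s)
      \<partial>gaussian p (\<lambda>i j. if i = j then s\<^sup>2 else 0))
    = ennreal (1 / sqrt (1 - (c\<^sup>2 * (\<Sum>i<p. v i * u i))\<^sup>2))"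
proof -
  let ?Z = "PiM {..<p} (\<lambda>_. std_normal_distribution)"
  define T where "T = (\<lambda>x. \<lambda>i\<in>{..<p}. s * x i)"
  have T' [measurable]: "T \<in> measurable ?Z (Rp p)"
    unfolding T_def measurable_cong_sets[OF sets_PiM_std_normal sets_Rp] by measurable
  have inv: "(\<lambda>i\<in>{..<p}. T x i / s) = x" if "x \<in> space ?Z" for x
    using that assms by (auto simp: T_def space_PiM PiE_iff extensional_def)
  note [measurable] = measurable_spike_lr_scaled
  have "gaussian p (\<lambda>i j. if i = j then s\<^sup>2 else 0) = distr ?Z (Rp p) T"
    unfolding T_def using assms by (subst gaussian_scaled_identity) auto
  then have "(\<integral>\<^sup>+y. spike_lr p c v (\<lambda>i\<in>{..<p}. y i / s) * spike_lr p c u (\<lambda>i\<in>{..<p}. y i / s)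
      \<partial>gaussian p (\<lambda>i j. if i = j then s\<^sup>2 else 0)) =
    (\<integral>\<^sup>+x. spike_lr p c v (\<lambda>i\<in>{..<p}. T x i / s) * spike_lr p c u (\<lambda>i\<in>{..<p}. T x i / s) \<partial>?Z)"
    by (simp only:) (rule nn_integral_distr; measurable)
  also have "\<dots> = (\<integral>\<^sup>+x. spike_lr p c v x * spike_lr p c u x \<partial>?Z)"
    by (intro nn_integral_cong) (simp only: inv)
  finally show ?thesis
    unfolding nn_integral_spike_lr_mult[OF assms(2)] .
qed

subsection \<open>Spectral norm\<close>

lemma vnorm_eq_L2_set: "vnorm p x = L2_set x {..<p}"
  by (simp add: vnorm_def L2_set_def)

lemma vnorm_nonneg: "0 \<le> vnorm p x"
  by (simp add: vnorm_eq_L2_set)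

lemma vnorm_scale: "vnorm p (\<lambda>i. c * x i) = \<bar>c\<bar> * vnorm p x"
  by (simp add: vnorm_def power_mult_distrib real_sqrt_mult flip: sum_distrib_left)

lemma vnorm_add: "vnorm p (\<lambda>i. x i + y i) \<le> vnorm p x + vnorm p y"
  by (simp add: vnorm_eq_L2_set L2_set_triangle_ineq)

lemma abs_inner_le_vnorm: "\<bar>\<Sum>i<p. x i * y i\<bar> \<le> vnorm p x * vnorm p y"
proof -
  have "\<bar>\<Sum>i<p. x i * y i\<bar> \<le> (\<Sum>i<p. \<bar>x i\<bar> * \<bar>y i\<bar>)"
    by (rule order_trans[OF sum_abs]) (simp add: abs_mult)
  also have "\<dots> \<le> vnorm p x * vnorm p y"
    unfolding vnorm_eq_L2_set by (rule L2_set_mult_ineq)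
  finally show ?thesis .
qed

text \<open>Crude, but enough to bound the set whose \<open>Sup\<close> is \<open>spec_norm\<close>
  and to send vectors of norm 0 to vectors of norm 0.\<close>

lemma vnorm_mat_vec_bounded: "vnorm p (mat_vec p A x) \<le> (\<Sum>i<p. vnorm p (A i)) * vnorm p x"
proof -
  have "vnorm p (mat_vec p A x) \<le> (\<Sum>i<p. \<bar>\<Sum>j<p. A i j * x j\<bar>)"
    unfolding vnorm_eq_L2_set mat_vec_def by (rule L2_set_le_sum_abs)
  also have "\<dots> \<le> (\<Sum>i<p. vnorm p (A i) * vnorm p x)"
    by (intro sum_mono abs_inner_le_vnorm)
  finally show ?thesis by (simp add: sum_distrib_right)
qed

lemma vnorm_mat_vec_le_spec_norm:
  assumes "vnorm p x \<le> 1"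
  shows "vnorm p (mat_vec p A x) \<le> spec_norm p A"
proof -
  have "vnorm p (mat_vec p A y) \<le> (\<Sum>i<p. vnorm p (A i))" if "vnorm p y \<le> 1" for y
    using vnorm_mat_vec_bounded[of p A y] mult_left_le[OF that, of "\<Sum>i<p. vnorm p (A i)"]
    by (simp add: sum_nonneg vnorm_nonneg)
  then have "bdd_above {vnorm p (mat_vec p A x) | x. vnorm p x \<le> 1}"
    by (auto simp: bdd_above_def)
  then show ?thesis
    unfolding spec_norm_def using assms by (intro cSup_upper) auto
qed

lemma spec_norm_leI:
  assumes "\<And>x. vnorm p x \<le> 1 \<Longrightarrow> vnorm p (mat_vec p A x) \<le> c"
  shows "spec_norm p A \<le> c"
  unfolding spec_norm_def
proof (rule cSup_least)
  have "vnorm p (\<lambda>_. 0) \<le> 1" by (simp add: vnorm_def)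
  then show "{vnorm p (mat_vec p A x) | x. vnorm p x \<le> 1} \<noteq> {}" by blast
qed (use assms in auto)

lemma spec_norm_nonneg: "0 \<le> spec_norm p A"
  by (rule order_trans[OF vnorm_nonneg vnorm_mat_vec_le_spec_norm[of p "\<lambda>_. 0"]]) (simp add: vnorm_def)

text \<open>\<open>C\<close> stands for the estimate in every use: it cannot be close to both
  \<open>A\<close> and \<open>B\<close> when these are far apart.\<close>

lemma spec_norm_triangle:
  "spec_norm p (\<lambda>i j. A i j - B i j) \<le> spec_norm p (\<lambda>i j. A i j - C i j) + spec_norm p (\<lambda>i j. B i j - C i j)"
proof (rule spec_norm_leI)
  fix x assume x: "vnorm p x \<le> 1"
  have "mat_vec p (\<lambda>i j. A i j - B i j) x = (\<lambda>i. mat_vec p (\<lambda>i j. A i j - C i j) x i + (- 1) * mat_vec p (\<lambda>i j. B i j - C i j) x i)"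
    by (simp add: mat_vec_def left_diff_distrib flip: sum_subtractf)
  then have "vnorm p (mat_vec p (\<lambda>i j. A i j - B i j) x) \<le>
     vnorm p (mat_vec p (\<lambda>i j. A i j - C i j) x) + vnorm p (mat_vec p (\<lambda>i j. B i j - C i j) x)"
    using vnorm_add[of p "mat_vec p (\<lambda>i j. A i j - C i j) x" "\<lambda>i. (- 1) * mat_vec p (\<lambda>i j. B i j - C i j) x i"]
    unfolding vnorm_scale by simp
  also have "\<dots> \<le> spec_norm p (\<lambda>i j. A i j - C i j) + spec_norm p (\<lambda>i j. B i j - C i j)"
    by (intro add_mono vnorm_mat_vec_le_spec_norm x)
  finally show "vnorm p (mat_vec p (\<lambda>i j. A i j - B i j) x) \<le> \<dots>" .
qed

lemma mat_vec_identity_plus_rank_one: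
  assumes "i < p"
  shows "mat_vec p (\<lambda>i j. (if i = j then a else 0) + b * v i * v j) x i = a * x i + b * (\<Sum>j<p. v j * x j) * v i"
proof -
  have "mat_vec p (\<lambda>i j. (if i = j then a else 0) + b * v i * v j) x i =
     (\<Sum>j<p. (if i = j then a * x i else 0) + b * v i * (v j * x j))"
    unfolding mat_vec_def by (intro sum.cong refl) (auto simp: algebra_simps)
  then show ?thesis using assms by (simp add: sum.distrib flip: sum_distrib_left)
qed

text \<open>The triangle and Cauchy-Schwarz inequalities bound the norm, and \<open>v\<close> itself
  attains the bound. The case a = 0 measures distances between hypotheses.\<close>

lemma spec_norm_identity_plus_rank_one:
  assumes v: "(\<Sum>i<p. (v i)\<^sup>2) = 1" and "0 \<le> a" "0 \<le> b"
  shows "spec_norm p (\<lambda>i j. (if i = j then a else 0) + b * v i * v j) = a + b"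
proof (rule antisym)
  let ?M = "\<lambda>i j. (if i = j then a else 0) + b * v i * v j"
  have nv: "vnorm p v = 1" using v by (simp add: vnorm_def)
  have mv: "vnorm p (mat_vec p ?M x) = vnorm p (\<lambda>i. a * x i + (b * (\<Sum>j<p. v j * x j)) * v i)" for x
    unfolding vnorm_def by (simp add: mat_vec_identity_plus_rank_one)
  show "spec_norm p ?M \<le> a + b"
  proof (rule spec_norm_leI)
    fix x assume x: "vnorm p x \<le> 1"
    have "vnorm p (mat_vec p ?M x) \<le> a * vnorm p x + b * \<bar>\<Sum>j<p. v j * x j\<bar>"
      unfolding mv using vnorm_add[of p "\<lambda>i. a * x i" "\<lambda>i. (b * (\<Sum>j<p. v j * x j)) * v i"] assms
      by (simp add: vnorm_scale nv abs_mult)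
    also have "\<dots> \<le> a * 1 + b * 1"
      using x abs_inner_le_vnorm[of v x p] assms(2,3) by (intro add_mono mult_left_mono) (auto simp: nv)
    finally show "vnorm p (mat_vec p ?M x) \<le> a + b" by simp
  qed
  have "a + b = vnorm p (\<lambda>i. (a + b) * v i)"
    using assms(2,3) by (simp add: vnorm_scale nv)
  also have "\<dots> = vnorm p (mat_vec p ?M v)"
    unfolding mv using v by (simp add: power2_eq_square distrib_right)
  also have "\<dots> \<le> spec_norm p ?M"
    by (rule vnorm_mat_vec_le_spec_norm) (simp add: nv)
  finally show "a + b \<le> spec_norm p ?M" .
qed

lemma psd_identity_plus_rank_one:
  assumes "0 \<le> a" "0 \<le> b"
  shows "psd p (\<lambda>i j. (if i = j then a else 0) + b * v i * v j)"
  unfolding psd_def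
proof (intro conjI allI impI)
  fix x :: "nat \<Rightarrow> real"
  have "(\<Sum>i<p. \<Sum>j<p. x i * ((if i = j then a else 0) + b * v i * v j) * x j) =
    (\<Sum>i<p. x i * mat_vec p (\<lambda>i j. (if i = j then a else 0) + b * v i * v j) x i)"
    by (simp add: mat_vec_def sum_distrib_left mult.assoc)
  also have "\<dots> = (\<Sum>i<p. a * (x i)\<^sup>2 + b * (\<Sum>j<p. v j * x j) * (v i * x i))"
    by (intro sum.cong refl, subst mat_vec_identity_plus_rank_one) (simp_all add: algebra_simps power2_eq_square)
  also have "\<dots> = a * (\<Sum>i<p. (x i)\<^sup>2) + b * (\<Sum>j<p. v j * x j)\<^sup>2"
    by (simp add: sum.distrib power2_eq_square flip: sum_distrib_left)
  also have "0 \<le> \<dots>" using assms by (intro add_nonneg_nonneg mult_nonneg_nonneg sum_nonneg) auto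
  finally show "0 \<le> (\<Sum>i<p. \<Sum>j<p. x i * ((if i = j then a else 0) + b * v i * v j) * x j)" .
qed simp

section \<open>Measurability of the spectral norm\<close>

lemma tendsto_vnorm:
  assumes "\<And>i. i < p \<Longrightarrow> (\<lambda>n. y n i) \<longlonglongrightarrow> x i"
  shows "(\<lambda>n. vnorm p (y n)) \<longlonglongrightarrow> vnorm p x"
  unfolding vnorm_def using assms by (intro tendsto_intros) auto

text \<open>Countably many test vectors make the norm measurable in the matrix. The inequality is
  homogenised because rational approximants q of a vector x in the unit ball may leave it, whereas r
  |q| tends to r |x| in any case.\<close>

lemma spec_norm_le_iff:
  assumes "0 \<le> r"
  shows "spec_norm p A \<le> r \<longleftrightarrow> (\<forall>x\<in>PiE {..<p} (\<lambda>_. \<rat>). vnorm p (mat_vec p A x) \<le> r * vnorm p x)"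
proof safe
  fix x assume le: "spec_norm p A \<le> r"
  show "vnorm p (mat_vec p A x) \<le> r * vnorm p x"
  proof (cases "vnorm p x = 0")
    case True
    then show ?thesis using vnorm_mat_vec_bounded[of p A x] by (simp add: True)
  next
    case False
    then have pos: "vnorm p x > 0" using vnorm_nonneg[of p x] by simp
    have "mat_vec p A (\<lambda>i. (1 / vnorm p x) * x i) = (\<lambda>i. (1 / vnorm p x) * mat_vec p A x i)"
      by (simp add: mat_vec_def sum_distrib_left sum_divide_distrib)
    then have "(1 / vnorm p x) * vnorm p (mat_vec p A x) = vnorm p (mat_vec p A (\<lambda>i. (1 / vnorm p x) * x i))"
      using pos by (simp only: vnorm_scale) simp
    also have "\<dots> \<le> spec_norm p A"
      by (rule vnorm_mat_vec_le_spec_norm) (use pos in \<open>simp only: vnorm_scale\<close>, simp)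
    finally have "(1 / vnorm p x) * vnorm p (mat_vec p A x) \<le> spec_norm p A" .
    then show ?thesis using order_trans[OF _ mult_right_mono[OF le vnorm_nonneg[of p x]]] pos by (simp add: divide_le_eq)
  qed
next
  assume *: "\<forall>x\<in>PiE {..<p} (\<lambda>_. \<rat>). vnorm p (mat_vec p A x) \<le> r * vnorm p x"
  show "spec_norm p A \<le> r"
  proof (rule spec_norm_leI)
    fix x assume x: "vnorm p x \<le> 1"
    have ex: "\<exists>q. q \<in> \<rat> \<and> \<bar>q - x i\<bar> < 1 / real (Suc n)" for i n
      using Rats_dense_in_real[of "x i" "x i + 1 / real (Suc n)"] by force
    define q where "q n i = (SOME q. q \<in> \<rat> \<and> \<bar>q - x i\<bar> < 1 / real (Suc n))" for n i
    have q: "q n i \<in> \<rat>" "\<bar>q n i - x i\<bar> < 1 / real (Suc n)" for n i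
      using someI_ex[OF ex[of i n]] by (auto simp: q_def)
    have lim: "(\<lambda>n. q n i) \<longlonglongrightarrow> x i" for i
    proof (rule LIM_zero_cancel, rule Lim_null_comparison)
      show "\<forall>\<^sub>F n in sequentially. norm (q n i - x i) \<le> 1 / real (Suc n)"
        using q(2) by (auto intro!: always_eventually less_imp_le)
    qed (rule LIMSEQ_Suc[OF lim_1_over_n])
    have le: "vnorm p (mat_vec p A (q n)) \<le> r * vnorm p (q n)" for n
    proof -
      \<comment> \<open>Extensionality makes the test set countable; norm and product read only the
        coordinates below \<open>p\<close>, so restricting changes neither.\<close>
      have "vnorm p (mat_vec p A (restrict (q n) {..<p})) \<le> r * vnorm p (restrict (q n) {..<p})"
        using * q(1) by auto
      then show ?thesis by (simp add: vnorm_def mat_vec_def)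
    qed
    have "(\<lambda>n. vnorm p (mat_vec p A (q n))) \<longlonglongrightarrow> vnorm p (mat_vec p A x)"
      by (rule tendsto_vnorm) (unfold mat_vec_def, intro tendsto_intros lim)
    moreover have "(\<lambda>n. r * vnorm p (q n)) \<longlonglongrightarrow> r * vnorm p x"
      by (intro tendsto_intros tendsto_vnorm lim)
    ultimately have "vnorm p (mat_vec p A x) \<le> r * vnorm p x"
      using le by (auto intro: LIMSEQ_le)
    also have "\<dots> \<le> r" using x assms by (simp add: mult_left_le)
    finally show "vnorm p (mat_vec p A x) \<le> r" .
  qed
qed

lemma borel_measurable_spec_norm:
  assumes [measurable]: "\<And>i j. i < p \<Longrightarrow> j < p \<Longrightarrow> (\<lambda>x. A x i j) \<in> borel_measurable M"
  shows "(\<lambda>x. spec_norm p (A x)) \<in> borel_measurable M"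
  unfolding borel_measurable_iff_le
proof
  fix r
  show "{w \<in> space M. spec_norm p (A w) \<le> r} \<in> sets M"
  proof (cases "0 \<le> r")
    case True
    have [simp]: "countable (PiE {..<p} (\<lambda>_. \<rat> :: real set))"
      by (intro countable_PiE countable_rat) auto
    have [measurable]: "(\<lambda>w. vnorm p (mat_vec p (A w) x)) \<in> borel_measurable M" for x
      unfolding vnorm_def mat_vec_def by measurable
    show ?thesis unfolding spec_norm_le_iff[OF True]
      by (rule sets.sets_Collect_countable_All') auto
  next
    case False
    then have "{w \<in> space M. spec_norm p (A w) \<le> r} = {}"
      using order_trans[OF spec_norm_nonneg] by auto
    then show ?thesis by (simp only: sets.empty_sets)
  qed
qed

subsection \<open>The random-sign block prior\<close>

text \<open>The left side is 2 sinh^2 (x / 2), and with y = |x| / 2 one has exp y - exp (-y) = exp y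
  (1 - exp (-2 y)) <= 2 y exp y.\<close>

lemma cosh_minus_one_le: "(exp x + exp (- x)) / 2 - 1 \<le> x\<^sup>2 / 2 * exp \<bar>x :: real\<bar>"
proof -
  define y where "y = \<bar>x\<bar> / 2"
  have y: "0 \<le> y" by (simp add: y_def)
  have "1 - exp (- (2 * y)) \<le> 2 * y"
    using exp_ge_add_one_self[of "- (2 * y)"] by simp
  then have "exp y * (1 - exp (- (2 * y))) \<le> exp y * (2 * y)"
    by (intro mult_left_mono) auto
  moreover have "exp y * (1 - exp (- (2 * y))) = exp y - exp (- y)"
    by (simp add: algebra_simps flip: exp_add)
  ultimately have "(exp y - exp (- y))\<^sup>2 \<le> (exp y * (2 * y))\<^sup>2"
    using y by (intro power_mono) auto
  moreover have "(exp y - exp (- y))\<^sup>2 = exp x + exp (- x) - 2"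
    by (cases "x \<ge> 0") (auto simp: y_def power2_eq_square algebra_simps simp flip: exp_add)
  moreover have "(exp y * (2 * y))\<^sup>2 = x\<^sup>2 * exp \<bar>x\<bar>"
    by (simp add: y_def power_mult_distrib flip: exp_double)
  ultimately have "exp x + exp (- x) - 2 \<le> x\<^sup>2 * exp \<bar>x\<bar>" by simp
  then show ?thesis by (simp add: field_simps)
qed

lemma exp_plus_exp_minus_ge: "2 \<le> exp x + exp (- x :: real)"
  using exp_ge_add_one_self[of x] exp_ge_add_one_self[of "- x"] by linarith

text \<open>The left side is the moment generating function of a variable equal to 1 or -1 with
  probability 1 / (2 b) each and to 0 otherwise. Let L = 1 + ln b. For |x| <= L / 2 the factor exp
  |x| of the second-order bound is outweighed by 1 / b, leaving at most 4 / L. For larger |x| the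
  division by b is dropped and cosh x <= exp |x| suffices, since then |x| <= 2 x^2 / L.\<close>

lemma cosh_mixture_le:
  assumes b: "1 \<le> (b :: real)"
  shows "1 + ((exp x + exp (- x)) / 2 - 1) / b \<le> exp (2 * x\<^sup>2 / (1 + ln b))"
proof -
  define L where "L = 1 + ln b"
  have L: "1 \<le> L" using b by (simp add: L_def)
  show ?thesis
  proof (cases "\<bar>x\<bar> \<le> L / 2")
    case True
    have "L / 2 \<le> exp (L / 2 - 1)"
      using exp_ge_add_one_self[of "L / 2 - 1"] by simp
    then have "L / 2 * exp (1 - L / 2) \<le> exp (L / 2 - 1) * exp (1 - L / 2)"
      by (intro mult_right_mono) auto
    then have e: "exp (1 - L / 2) \<le> 4 / L"
      using L by (simp add: field_simps flip: exp_add)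
    have "exp \<bar>x\<bar> / b \<le> exp (L / 2) / b" using True b by (intro divide_right_mono) auto
    also have "\<dots> = exp (1 - L / 2)"
    proof -
      have "b = exp (L - 1)" using b by (simp add: L_def)
      then have "exp (L / 2) / b = exp (L / 2 - (L - 1))" by (simp only: exp_diff)
      then show ?thesis by (simp add: field_simps)
    qed
    finally have "exp \<bar>x\<bar> / b \<le> 4 / L" using e by linarith
    then have "x\<^sup>2 / 2 * (exp \<bar>x\<bar> / b) \<le> x\<^sup>2 / 2 * (4 / L)"
      by (intro mult_left_mono) auto
    moreover have "((exp x + exp (- x)) / 2 - 1) / b \<le> x\<^sup>2 / 2 * exp \<bar>x\<bar> / b"
      using b by (intro divide_right_mono cosh_minus_one_le) auto
    ultimately have "1 + ((exp x + exp (- x)) / 2 - 1) / b \<le> 1 + 2 * x\<^sup>2 / L"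
      by simp
    also have "\<dots> \<le> exp (2 * x\<^sup>2 / L)" by (rule exp_ge_add_one_self)
    finally show ?thesis by (simp add: L_def)
  next
    case False
    have c: "0 \<le> (exp x + exp (- x)) / 2 - 1"
      using exp_plus_exp_minus_ge[of x] by simp
    have "1 + ((exp x + exp (- x)) / 2 - 1) / b \<le> 1 + ((exp x + exp (- x)) / 2 - 1)"
      using divide_left_mono[OF b c] b by (intro add_left_mono) (simp only: div_by_1)
    also have "\<dots> \<le> exp \<bar>x\<bar>"
    proof -
      have "exp x + exp (- x) \<le> exp \<bar>x\<bar> + exp \<bar>x\<bar>" by (intro add_mono) auto
      then show ?thesis by simp
    qed
    also have "\<bar>x\<bar> \<le> 2 * x\<^sup>2 / L"
    proof -
      have "\<bar>x\<bar> * L \<le> \<bar>x\<bar> * (2 * \<bar>x\<bar>)" using False by (intro mult_left_mono) auto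
      then show ?thesis using L by (simp add: field_simps power2_eq_square abs_mult_self_eq)
    qed
    finally show ?thesis by (simp add: L_def)
  qed
qed

text \<open>A slot is a position within a block together with a sign.\<close>
definition slots :: "nat \<Rightarrow> (nat \<times> real) set" where
  "slots b = {..<b} \<times> {-1, 1}"

text \<open>This is s times the contribution of one block to the inner product of two spike
  vectors.\<close>

definition slot_prod :: "nat \<times> real \<Rightarrow> nat \<times> real \<Rightarrow> real" where
  "slot_prod a a' = (if fst a = fst a' then snd a * snd a' else 0)"

text \<open>The uniform law on this finite set is the prior; averages over it are written as sums
  against its cardinality.\<close>

definition prior :: "nat \<Rightarrow> nat \<Rightarrow> (nat \<Rightarrow> nat \<times> real) set" where
  "prior s b = PiE {..<s} (\<lambda>_. slots b)"

lemma finite_prior [simp]: "finite (prior s b)"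
  by (auto simp: prior_def slots_def intro!: finite_PiE)

lemma card_slots: "card (slots b) = 2 * b"
  by (simp add: slots_def card_cartesian_product)

lemma card_prior: "card (prior s b) = (2 * b) ^ s"
  by (simp add: prior_def card_PiE card_slots)

text \<open>Of the 2 b slots, two share the position of \<open>a'\<close> and give exp x and exp (-
  x), while all others give 1. Hence averaging over one draw removes the dependence on the
  other.\<close>

lemma sum_exp_slot_prod:
  assumes "a' \<in> slots b"
  shows "(\<Sum>a\<in>slots b. exp (x * slot_prod a a')) = real (2 * b) * (1 + ((exp x + exp (- x)) / 2 - 1) / real b)"
proof -
  obtain j' e where a': "a' = (j', e)" "j' < b" "e = - 1 \<or> e = 1"
    using assms by (auto simp: slots_def)
  have "(\<Sum>a\<in>slots b. exp (x * slot_prod a a')) = (\<Sum>j<b. \<Sum>e'\<in>{-1,1}. exp (x * slot_prod (j, e') a'))"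
    unfolding slots_def by (simp only: sum.cartesian_product split_def prod.collapse)
  also have "\<dots> = (\<Sum>j<b. 2 + (if j = j' then exp x + exp (- x) - 2 else 0))"
    by (intro sum.cong refl) (use a'(3) in \<open>auto simp: slot_prod_def a'(1)\<close>)
  also have "\<dots> = 2 * real b + (exp x + exp (- x) - 2)"
    using a'(2) by (simp add: sum.distrib)
  also have "\<dots> = real (2 * b) * (1 + ((exp x + exp (- x)) / 2 - 1) / real b)"
  proof -
    have "2 * r + (k - 2) = 2 * r * (1 + (k / 2 - 1) / r)" if "r > 0" for r k :: real
      using that by (simp add: field_simps)
    from this[of "real b" "exp x + exp (- x)"] show ?thesis using a'(2) by simp
  qed
  finally show ?thesis .
qed

lemma sum_exp_prior_le:
  assumes b: "1 \<le> b" and w': "\<omega>' \<in> prior s b"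
  shows "(\<Sum>\<omega>\<in>prior s b. exp (x * (\<Sum>i<s. slot_prod (\<omega> i) (\<omega>' i)))) \<le>
    real (card (prior s b)) * exp (2 * real s * x\<^sup>2 / (1 + ln (real b)))"
proof -
  have w'i: "\<omega>' i \<in> slots b" if "i < s" for i using w' that by (auto simp: prior_def)
  have "(\<Sum>\<omega>\<in>prior s b. exp (x * (\<Sum>i<s. slot_prod (\<omega> i) (\<omega>' i)))) =
    (\<Sum>\<omega>\<in>prior s b. \<Prod>i<s. exp (x * slot_prod (\<omega> i) (\<omega>' i)))"
    by (simp add: sum_distrib_left exp_sum)
  also have "\<dots> = (\<Prod>i<s. \<Sum>a\<in>slots b. exp (x * slot_prod a (\<omega>' i)))"
    unfolding prior_def by (rule prod_sum_PiE[symmetric]) (auto simp: slots_def)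
  also have "\<dots> = (\<Prod>i<s. real (2 * b) * (1 + ((exp x + exp (- x)) / 2 - 1) / real b))"
    by (intro prod.cong refl sum_exp_slot_prod w'i) auto
  also have "\<dots> \<le> (\<Prod>i<s. real (2 * b) * exp (2 * x\<^sup>2 / (1 + ln (real b))))"
  proof (intro prod_mono conjI mult_left_mono cosh_mixture_le)
    have c: "0 \<le> (exp x + exp (- x)) / 2 - 1"
      using exp_plus_exp_minus_ge[of x] by simp
    show "0 \<le> real (2 * b) * (1 + ((exp x + exp (- x)) / 2 - 1) / real b)"
      by (intro mult_nonneg_nonneg add_nonneg_nonneg divide_nonneg_nonneg c) auto
  qed (use b in auto)
  also have "\<dots> = real (card (prior s b)) * exp (2 * real s * x\<^sup>2 / (1 + ln (real b)))"
    by (simp add: card_prior power_mult_distrib flip: exp_of_nat_mult)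
  finally show ?thesis .
qed

text \<open>The square is linearised: exp (t S^2) is the mean of exp (sqrt (2 t) g S) over a standard
  normal g.\<close>
lemma sum_exp_square_prior_le:
  assumes b: "1 \<le> b" and w': "\<omega>' \<in> prior s b" and t: "0 \<le> t" "16 * t * real s \<le> 1 + ln (real b)"
  shows "(\<Sum>\<omega>\<in>prior s b. exp (t * (\<Sum>i<s. slot_prod (\<omega> i) (\<omega>' i))\<^sup>2)) \<le> 2 * real (card (prior s b))"
proof -
  define S where "S \<omega> = (\<Sum>i<s. slot_prod (\<omega> i) (\<omega>' i))" for \<omega>
  define L where "L = 1 + ln (real b)"
  have L: "1 \<le> L" using b by (simp add: L_def)
  \<comment> \<open>Inserting sqrt (2 t) g into the exponential bound gives the exponent 4 t s g^2 /
    L, which is a g^2 / 2. The constant 16 in the hypothesis makes a <= 1/2, so that the Gaussian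
    mean 1 / sqrt (1 - a) stays below 2.\<close>
  define a where "a = 8 * t * real s / L"
  have a: "a \<le> 1 / 2" using t(2) L by (simp add: a_def L_def[symmetric] field_simps)
  have "ennreal (\<Sum>\<omega>\<in>prior s b. exp (t * (S \<omega>)\<^sup>2)) = (\<Sum>\<omega>\<in>prior s b. ennreal (exp ((sqrt (2 * t) * S \<omega>)\<^sup>2 / 2)))"
    using t(1) by (subst sum_ennreal) (auto simp: power_mult_distrib)
  also have "\<dots> = (\<integral>\<^sup>+g. (\<Sum>\<omega>\<in>prior s b. ennreal (exp (sqrt (2 * t) * S \<omega> * g))) \<partial>std_normal_distribution)"
    unfolding nn_integral_std_normal_exp[symmetric] by (rule nn_integral_sum[symmetric]) measurable
  also have "\<dots> \<le> (\<integral>\<^sup>+g. ennreal (real (card (prior s b))) * ennreal (exp (a * g\<^sup>2 / 2)) \<partial>std_normal_distribution)"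
  proof (rule nn_integral_mono)
    fix g :: real
    have "(\<Sum>\<omega>\<in>prior s b. ennreal (exp (sqrt (2 * t) * S \<omega> * g))) = ennreal (\<Sum>\<omega>\<in>prior s b. exp ((sqrt (2 * t) * g) * S \<omega>))"
      by (subst sum_ennreal) (auto simp: mult_ac)
    also have "\<dots> \<le> ennreal (real (card (prior s b)) * exp (2 * real s * (sqrt (2 * t) * g)\<^sup>2 / L))"
      unfolding S_def L_def by (intro ennreal_leI sum_exp_prior_le b w')
    also have "2 * real s * (sqrt (2 * t) * g)\<^sup>2 / L = a * g\<^sup>2 / 2"
      using t(1) by (simp add: power_mult_distrib a_def)
    finally show "(\<Sum>\<omega>\<in>prior s b. ennreal (exp (sqrt (2 * t) * S \<omega> * g))) \<le> ennreal (real (card (prior s b))) * ennreal (exp (a * g\<^sup>2 / 2))"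
      by (simp add: ennreal_mult)
  qed
  also have "\<dots> = ennreal (real (card (prior s b))) * ennreal (1 / sqrt (1 - a))"
    using a by (subst nn_integral_cmult, simp, subst nn_integral_std_normal_exp_square) auto
  also have "\<dots> \<le> ennreal (real (card (prior s b))) * ennreal 2"
  proof (intro mult_left_mono ennreal_leI)
    have "1 / 2 \<le> sqrt (1 - a)" by (rule real_le_rsqrt) (use a in \<open>simp add: power2_eq_square\<close>)
    then show "1 / sqrt (1 - a) \<le> 2" using a by (simp add: field_simps)
  qed simp
  also have "\<dots> = ennreal (2 * real (card (prior s b)))"
    by (simp add: ennreal_mult mult.commute)
  finally show ?thesis
    by (subst (asm) ennreal_le_iff) (simp_all add: S_def)
qed

subsection \<open>Le Cam's method for the spiked model\<close>

text \<open>Division with remainder splits a coordinate into its block and its position there;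
  coordinates beyond the last block stay 0. The scaling gives unit length.\<close>

definition spike_vec :: "nat \<Rightarrow> nat \<Rightarrow> (nat \<Rightarrow> nat \<times> real) \<Rightarrow> nat \<Rightarrow> real" where
  "spike_vec s b \<omega> q = (if q < s * b \<and> fst (\<omega> (q div b)) = q mod b then snd (\<omega> (q div b)) / sqrt (real s) else 0)"

lemma sum_spike_vec_mult:
  assumes b: "1 \<le> b" "s * b \<le> p" and w: "\<omega> \<in> prior s b" "\<omega>' \<in> prior s b"
  shows "(\<Sum>q<p. spike_vec s b \<omega> q * spike_vec s b \<omega>' q) = (\<Sum>i<s. slot_prod (\<omega> i) (\<omega>' i)) / real s"
proof -
  let ?f = "\<lambda>q. spike_vec s b \<omega> q * spike_vec s b \<omega>' q"
  have "(\<Sum>q<p. ?f q) = (\<Sum>q<s * b. ?f q)"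
    using b by (intro sum.mono_neutral_right) (auto simp: spike_vec_def)
  also have "\<dots> = (\<Sum>i<s. sum ?f {i * b..<i * b + b})"
    by (rule sum.nat_group[symmetric])
  also have "\<dots> = (\<Sum>i<s. slot_prod (\<omega> i) (\<omega>' i) / real s)"
  proof (intro sum.cong refl)
    fix i assume "i \<in> {..<s}"
    then have i: "i < s" by simp
    have "\<omega> i \<in> slots b" "\<omega>' i \<in> slots b" using w i by (auto simp: prior_def)
    then have fb: "fst (\<omega> i) < b" by (auto simp: slots_def)
    have "sum ?f {i * b..<i * b + b} = (\<Sum>j<b. ?f (i * b + j))"
      using sum.shift_bounds_nat_ivl[of ?f 0 "i * b" b] by (simp add: add.commute atLeast0LessThan)
    also have "\<dots> = (\<Sum>j<b. if fst (\<omega> i) = j then slot_prod (\<omega> i) (\<omega>' i) / real s else 0)"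
    proof (intro sum.cong refl)
      fix j assume "j \<in> {..<b}"
      then have j: "j < b" by simp
      have "i * b + j < Suc i * b" using j by simp
      also have "\<dots> \<le> s * b" using i by (intro mult_right_mono) auto
      finally have "i * b + j < s * b" .
      then show "?f (i * b + j) = (if fst (\<omega> i) = j then slot_prod (\<omega> i) (\<omega>' i) / real s else 0)"
        using j by (auto simp: spike_vec_def slot_prod_def)
    qed
    also have "\<dots> = slot_prod (\<omega> i) (\<omega>' i) / real s" using fb by simp
    finally show "sum ?f {i * b..<i * b + b} = slot_prod (\<omega> i) (\<omega>' i) / real s" .
  qed
  finally show ?thesis by (simp add: sum_divide_distrib)
qed

lemma sum_spike_vec_square:
  assumes "1 \<le> s" "1 \<le> b" "s * b \<le> p" "\<omega> \<in> prior s b"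
  shows "(\<Sum>q<p. (spike_vec s b \<omega> q)\<^sup>2) = 1"
proof -
  have "slot_prod (\<omega> i) (\<omega> i) = 1" if "i < s" for i
  proof -
    have "\<omega> i \<in> slots b" using assms(4) that by (auto simp: prior_def)
    then show ?thesis by (auto simp: slots_def slot_prod_def)
  qed
  then show ?thesis
    using sum_spike_vec_mult[OF assms(2,3,4,4)] assms(1) by (simp add: power2_eq_square)
qed

text \<open>This is (r - 2 N)^2 >= 0 divided by 4 N. With \<open>a\<close> a sum of likelihood
  ratios, it passes from first to second moments without square roots or differences in
  \<open>ennreal\<close>.\<close>

lemma ennreal_le_square_plus:
  assumes "0 < N"
  shows "a \<le> a * a / ennreal (4 * N) + ennreal N"
proof (cases a)
  case top
  then show ?thesis using assms by (simp add: ennreal_top_mult ennreal_top_divide)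
next
  case (real r)
  have "0 \<le> (r - 2 * N)\<^sup>2" by simp
  then have "r * (4 * N) \<le> r * r + N * (4 * N)"
    by (simp add: power2_eq_square algebra_simps)
  then have "r \<le> r * r / (4 * N) + N"
    using assms by (simp add: field_simps)
  then show ?thesis
    using real assms by (simp add: divide_ennreal flip: ennreal_mult ennreal_plus)
qed

text \<open>Otherwise \<open>Q\<close> gives \<open>A\<close> mass below 1/4 and each of the N
  alternatives gives it more than 3/4, so the densities integrate over \<open>A\<close> to more than
  3 N / 4 in total. But \<open>ennreal_le_square_plus\<close> bounds this total by 2 N^2 / (4 N)
  plus N times the mass of \<open>A\<close> under \<open>Q\<close>, which is less than 3 N /
  4.\<close>

lemma mixture_le_cam:
  assumes Q: "prob_space Q" and V: "finite V" "V \<noteq> {}"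
    and f [measurable]: "\<And>v. v \<in> V \<Longrightarrow> f v \<in> borel_measurable Q"
    and D: "\<And>v. v \<in> V \<Longrightarrow> prob_space (density Q (f v))"
    and m2: "(\<Sum>v\<in>V. \<Sum>u\<in>V. \<integral>\<^sup>+x. f v x * f u x \<partial>Q) \<le> ennreal (2 * (real (card V))\<^sup>2)"
    and A [measurable]: "A \<in> sets Q"
  shows "1/4 \<le> measure Q A \<or> (\<exists>v\<in>V. 1/4 \<le> measure (density Q (f v)) (space Q - A))"
proof (rule ccontr)
  interpret prob_space Q by fact
  define N where "N = real (card V)"
  have N: "N > 0" using V by (simp add: N_def card_gt_0_iff)
  assume "\<not> (1/4 \<le> measure Q A \<or> (\<exists>v\<in>V. 1/4 \<le> measure (density Q (f v)) (space Q - A)))"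
  then have QA: "measure Q A < 1/4" by (simp add: not_le)
  have DA: "measure (density Q (f v)) (space Q - A) < 1/4" if "v \<in> V" for v
    using \<open>\<not> (_ \<or> _)\<close> that by (auto simp: not_le)
  have big: "3/4 < measure (density Q (f v)) A" if "v \<in> V" for v
    using DA[OF that] prob_space.prob_compl[OF D[OF that], of A] by simp
  have "ennreal (\<Sum>v\<in>V. measure (density Q (f v)) A) = (\<Sum>v\<in>V. emeasure (density Q (f v)) A)"
    using D V(1) by (subst sum_ennreal[symmetric])
      (auto intro!: sum.cong simp: finite_measure.emeasure_eq_measure prob_space_def)
  also have "\<dots> = (\<Sum>v\<in>V. \<integral>\<^sup>+x. f v x * indicator A x \<partial>Q)"
    by (intro sum.cong refl emeasure_density) auto
  also have "\<dots> = (\<integral>\<^sup>+x. (\<Sum>v\<in>V. f v x * indicator A x) \<partial>Q)"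
    by (rule nn_integral_sum[symmetric]) measurable
  also have "\<dots> \<le> (\<integral>\<^sup>+x. (\<Sum>v\<in>V. f v x) * (\<Sum>v\<in>V. f v x) / ennreal (4 * N) + ennreal N * indicator A x \<partial>Q)"
    using ennreal_le_square_plus[OF N]
    by (intro nn_integral_mono) (simp add: indicator_def)
  also have "\<dots> = (\<integral>\<^sup>+x. (\<Sum>v\<in>V. f v x) * (\<Sum>v\<in>V. f v x) / ennreal (4 * N) \<partial>Q) + ennreal N * emeasure Q A"
    by (subst nn_integral_add) (auto simp: nn_integral_cmult_indicator)
  also have "(\<integral>\<^sup>+x. (\<Sum>v\<in>V. f v x) * (\<Sum>v\<in>V. f v x) / ennreal (4 * N) \<partial>Q)
    = (\<integral>\<^sup>+x. (\<Sum>v\<in>V. \<Sum>u\<in>V. f v x * f u x) \<partial>Q) / ennreal (4 * N)"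
    by (subst nn_integral_divide) (auto simp: sum_product)
  also have "(\<integral>\<^sup>+x. (\<Sum>v\<in>V. \<Sum>u\<in>V. f v x * f u x) \<partial>Q) = (\<Sum>v\<in>V. \<Sum>u\<in>V. \<integral>\<^sup>+x. f v x * f u x \<partial>Q)"
    by (subst nn_integral_sum) (auto intro!: sum.cong nn_integral_sum)
  also have "(\<Sum>v\<in>V. \<Sum>u\<in>V. \<integral>\<^sup>+x. f v x * f u x \<partial>Q) / ennreal (4 * N) + ennreal N * emeasure Q A
    \<le> ennreal (2 * N\<^sup>2) / ennreal (4 * N) + ennreal N * emeasure Q A"
    using m2 unfolding N_def by (intro add_right_mono divide_right_mono_ennreal)
  also have "\<dots> = ennreal (N / 2 + N * measure Q A)"
    using N by (simp add: divide_ennreal emeasure_eq_measure power2_eq_square flip: ennreal_mult ennreal_plus)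
  finally have le: "(\<Sum>v\<in>V. measure (density Q (f v)) A) \<le> N / 2 + N * measure Q A"
    using N by (subst (asm) ennreal_le_iff) auto
  have "N * measure Q A < N * (1/4)" using QA N by simp
  moreover have "(\<Sum>v\<in>V. 3/4) < (\<Sum>v\<in>V. measure (density Q (f v)) A)"
    using V big by (intro sum_strict_mono) auto
  moreover have "(\<Sum>v\<in>V. 3/4) = N * (3/4)" by (simp add: N_def)
  ultimately show False using le by linarith
qed

lemma sets_PiM_sample:
  assumes "\<And>m. sets (P m) = sets (Rp p)"
  shows "sets (PiM {..<n} P) = sets (sample_space n p)"
  unfolding sample_space_def by (rule sets_PiM_cong) (use assms in auto)

lemma sets_error_event:
  assumes "estimator n p Sh" "sets Q = sets (sample_space n p)"
  shows "{x \<in> space Q. t \<le> spec_norm p (\<lambda>i j. S i j - Sh x i j)} \<in> sets Q"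
proof -
  have "(\<lambda>x. spec_norm p (\<lambda>i j. S i j - Sh x i j)) \<in> borel_measurable Q"
    using assms(1) unfolding estimator_def measurable_cong_sets[OF assms(2) refl]
    by (intro borel_measurable_spec_norm borel_measurable_diff) auto
  then show ?thesis by measurable
qed

text \<open>On [0, 1/2] the product (1 - y)(1 + 2 y) = 1 + y (1 - 2 y) is at least 1, hence 1 / (1 -
  y) <= exp (2 y). This is where the spike amplitude needs d^2 <= 1/2.\<close>

lemma inverse_sqrt_power_le:
  assumes "0 \<le> y" "y \<le> 1/2"
  shows "(1 / sqrt (1 - y)) ^ n \<le> exp (real n * y)"
proof -
  have "1 \<le> (1 - y) * (1 + 2 * y)"
    using assms mult_left_mono[of y "1/2" y] by (simp add: algebra_simps)
  also have "\<dots> \<le> (1 - y) * exp (2 * y)"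
    using assms exp_ge_add_one_self[of "2 * y"] by (intro mult_left_mono) auto
  finally have "1 \<le> sqrt ((1 - y) * exp (2 * y))" by simp
  also have "\<dots> = sqrt (1 - y) * exp y"
    by (simp add: real_sqrt_mult exp_double)
  finally have "1 / sqrt (1 - y) \<le> exp y"
    using assms by (simp add: divide_le_eq mult.commute)
  then have "(1 / sqrt (1 - y)) ^ n \<le> exp y ^ n"
    using assms by (intro power_mono) auto
  then show ?thesis by (simp add: exp_of_nat_mult)
qed

text \<open>One family covers all hypotheses: d = 0 is the null, and a = 0 gives the rank-one
  covariances of the contamination bound.\<close>

definition spiked :: "real \<Rightarrow> real \<Rightarrow> (nat \<Rightarrow> real) \<Rightarrow> nat \<Rightarrow> nat \<Rightarrow> real" where
  "spiked a d v = (\<lambda>i j. (if i = j then a else 0) + d * v i * v j)"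

text \<open>The null matrix and each alternative differ by a rank-one matrix of norm M d. An
  estimate within M d / 2 of the null is therefore more than M d / 2 away from every alternative, so
  a small error would yield a test that \<open>mixture_le_cam\<close> excludes.\<close>

lemma spike_lower_bound:
  assumes M: "0 < M" and s: "1 \<le> s" and b: "1 \<le> b" "s * b \<le> p"
    and d: "0 \<le> d" "d\<^sup>2 \<le> 1/2" "16 * real n * d\<^sup>2 \<le> real s * (1 + ln (real b))"
    and Sh: "estimator n p Sh"
  shows "\<exists>S \<in> insert (spiked M 0 (\<lambda>_. 0)) ((\<lambda>\<omega>. spiked M (M * d) (spike_vec s b \<omega>)) ` prior s b).
    1/4 \<le> err_prob n p (gaussian p S) S Sh (M * d / 2)"
proof -
  define P0 where "P0 = gaussian p (spiked M 0 (\<lambda>_. 0))"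
  define h where "h \<omega> y = spike_lr p (sqrt d) (spike_vec s b \<omega>) (\<lambda>i\<in>{..<p}. y i / sqrt M)" for \<omega> y
  define f where "f \<omega> x = (\<Prod>m<n. h \<omega> (x m))" for \<omega> and x :: "nat \<Rightarrow> nat \<Rightarrow> real"
  define Q where "Q = PiM {..<n} (\<lambda>_. P0)"
  note unit = sum_spike_vec_square[OF s b]
  have P0': "P0 = gaussian p (\<lambda>i j. if i = j then (sqrt M)\<^sup>2 else 0)"
    using M by (simp add: P0_def spiked_def cong: if_cong)
  have P0: "prob_space P0" "sets P0 = sets (Rp p)" by (simp_all add: P0_def prob_space_gaussian)
  interpret P0: prob_space P0 by fact
  interpret PP: product_sigma_finite "\<lambda>_. P0" by standard
  interpret Q: prob_space Q unfolding Q_def by (intro prob_space_PiM P0)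
  have sQ: "sets Q = sets (sample_space n p)" unfolding Q_def by (rule sets_PiM_sample) (simp add: P0)
  have hm [measurable]: "h \<omega> \<in> borel_measurable P0" for \<omega>
    unfolding h_def[abs_def] measurable_cong_sets[OF P0(2) refl] by (rule measurable_spike_lr_scaled)
  have fm [measurable]: "f \<omega> \<in> borel_measurable Q" for \<omega>
    unfolding f_def[abs_def] Q_def by measurable
  have dens1: "gaussian p (spiked M (M * d) (spike_vec s b \<omega>)) = density P0 (h \<omega>)" if "\<omega> \<in> prior s b" for \<omega>
    using gaussian_spike_eq_density[OF _ unit[OF that], of "sqrt M" "sqrt d"] M d(1)
    unfolding P0' h_def spiked_def by (simp cong: if_cong)
  have dens: "PiM {..<n} (\<lambda>_. gaussian p (spiked M (M * d) (spike_vec s b \<omega>))) = density Q (f \<omega>)"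
    if "\<omega> \<in> prior s b" for \<omega>
    unfolding dens1[OF that] Q_def f_def
    by (rule PiM_density) (auto simp: P0 simp flip: dens1[OF that] intro: prob_space_gaussian)
  have mom: "(\<integral>\<^sup>+x. f \<omega> x * f \<omega>' x \<partial>Q) \<le>
      ennreal (exp (real n * d\<^sup>2 / (real s)\<^sup>2 * (\<Sum>i<s. slot_prod (\<omega> i) (\<omega>' i))\<^sup>2))"
    if w: "\<omega> \<in> prior s b" "\<omega>' \<in> prior s b" for \<omega> \<omega>'
  proof -
    define \<rho> where "\<rho> = (\<Sum>q<p. spike_vec s b \<omega> q * spike_vec s b \<omega>' q)"
    have \<rho>1: "\<bar>\<rho>\<bar> \<le> 1"
      using abs_inner_le_vnorm[of "spike_vec s b \<omega>" "spike_vec s b \<omega>'" p] unit w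
      by (simp add: \<rho>_def vnorm_def)
    have d1: "d < 1"
      using d(2) power2_less_imp_less[of d 1] by simp
    have "\<bar>(sqrt d)\<^sup>2 * \<rho>\<bar> < 1"
      using d(1) d1 mult_mono[of d d "\<bar>\<rho>\<bar>" 1] \<rho>1 by (simp add: abs_mult)
    then have "(\<integral>\<^sup>+y. h \<omega> y * h \<omega>' y \<partial>P0) = ennreal (1 / sqrt (1 - ((sqrt d)\<^sup>2 * \<rho>)\<^sup>2))"
      unfolding P0' h_def \<rho>_def using M by (intro nn_integral_spike_lr_scaled_mult) auto
    then have 1: "(\<integral>\<^sup>+y. h \<omega> y * h \<omega>' y \<partial>P0) = ennreal (1 / sqrt (1 - (d * \<rho>)\<^sup>2))"
      using d(1) by simp
    have le: "(d * \<rho>)\<^sup>2 \<le> 1/2"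
    proof -
      have "\<rho>\<^sup>2 \<le> 1" using \<rho>1 by (simp add: abs_square_le_1)
      then have "d\<^sup>2 * \<rho>\<^sup>2 \<le> d\<^sup>2 * 1" by (intro mult_left_mono) auto
      then show ?thesis using d(2) by (simp add: power_mult_distrib)
    qed
    have "(\<integral>\<^sup>+x. f \<omega> x * f \<omega>' x \<partial>Q) = (\<integral>\<^sup>+x. (\<Prod>m<n. h \<omega> (x m) * h \<omega>' (x m)) \<partial>Q)"
      by (simp add: f_def prod.distrib)
    also have "\<dots> = (\<Prod>m<n. \<integral>\<^sup>+y. h \<omega> y * h \<omega>' y \<partial>P0)"
      unfolding Q_def by (rule PP.product_nn_integral_prod) auto
    also have "\<dots> = ennreal ((1 / sqrt (1 - (d * \<rho>)\<^sup>2)) ^ n)"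
      unfolding 1 using le by (simp add: ennreal_power)
    also have "\<dots> \<le> ennreal (exp (real n * (d * \<rho>)\<^sup>2))"
      by (intro ennreal_leI inverse_sqrt_power_le le) simp
    also have "real n * (d * \<rho>)\<^sup>2 = real n * d\<^sup>2 / (real s)\<^sup>2 * (\<Sum>i<s. slot_prod (\<omega> i) (\<omega>' i))\<^sup>2"
      unfolding \<rho>_def sum_spike_vec_mult[OF b w] by (simp add: power_mult_distrib power_divide)
    finally show ?thesis .
  qed
  \<comment> \<open>The moment bound has exponent n d^2 \<rho>^2, where \<rho> is 1 / s times the
    sum of the slot products. Divided by s, the third condition on \<open>d\<close> is the one
    required of \<open>t\<close>.\<close>
  define t where "t = real n * d\<^sup>2 / (real s)\<^sup>2"
  have t: "0 \<le> t" "16 * t * real s \<le> 1 + ln (real b)"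
    using s d by (auto simp: t_def field_simps power2_eq_square)
  have ne: "prior s b \<noteq> {}"
    using b by (auto simp: prior_def PiE_eq_empty_iff slots_def lessThan_empty_iff)
  have "(\<Sum>\<omega>'\<in>prior s b. \<Sum>\<omega>\<in>prior s b. \<integral>\<^sup>+x. f \<omega>' x * f \<omega> x \<partial>Q)
     \<le> (\<Sum>\<omega>'\<in>prior s b. \<Sum>\<omega>\<in>prior s b. ennreal (exp (t * (\<Sum>i<s. slot_prod (\<omega> i) (\<omega>' i))\<^sup>2)))"
    using mom unfolding t_def by (intro sum_mono) (subst mult.commute, auto)
  also have "\<dots> = (\<Sum>\<omega>'\<in>prior s b. ennreal (\<Sum>\<omega>\<in>prior s b. exp (t * (\<Sum>i<s. slot_prod (\<omega> i) (\<omega>' i))\<^sup>2)))"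
    by (intro sum.cong refl sum_ennreal) auto
  also have "\<dots> \<le> (\<Sum>\<omega>'\<in>prior s b. ennreal (2 * real (card (prior s b))))"
    by (intro sum_mono ennreal_leI sum_exp_square_prior_le b t) auto
  also have "\<dots> = ennreal (2 * (real (card (prior s b)))\<^sup>2)"
    by (subst sum_ennreal) (auto simp: power2_eq_square)
  finally have m2: "(\<Sum>\<omega>\<in>prior s b. \<Sum>\<omega>'\<in>prior s b. \<integral>\<^sup>+x. f \<omega> x * f \<omega>' x \<partial>Q) \<le> \<dots>" .
  define A where "A = {x \<in> space Q. M * d / 2 \<le> spec_norm p (\<lambda>i j. spiked M 0 (\<lambda>_. 0) i j - Sh x i j)}"
  have A: "A \<in> sets Q" unfolding A_def by (rule sets_error_event[OF Sh sQ])
  have Dp: "prob_space (density Q (f \<omega>))" if "\<omega> \<in> prior s b" for \<omega>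
    unfolding dens[OF that, symmetric] by (intro prob_space_PiM prob_space_gaussian)
  from mixture_le_cam[OF Q.prob_space_axioms finite_prior ne fm Dp m2 A]
  consider "1/4 \<le> measure Q A" | \<omega> where "\<omega> \<in> prior s b" "1/4 \<le> measure (density Q (f \<omega>)) (space Q - A)"
    by blast
  then show ?thesis
  proof cases
    case 1
    then have "1/4 \<le> err_prob n p (gaussian p (spiked M 0 (\<lambda>_. 0))) (spiked M 0 (\<lambda>_. 0)) Sh (M * d / 2)"
      by (simp add: err_prob_def A_def Q_def P0_def)
    then show ?thesis by blast
  next
    case (2 \<omega>)
    let ?S = "spiked M (M * d) (spike_vec s b \<omega>)"
    let ?E = "{x \<in> space (density Q (f \<omega>)). M * d / 2 \<le> spec_norm p (\<lambda>i j. ?S i j - Sh x i j)}"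
    interpret D: prob_space "density Q (f \<omega>)" using Dp 2(1) .
    have "spec_norm p (\<lambda>i j. ?S i j - spiked M 0 (\<lambda>_. 0) i j) = M * d"
      using spec_norm_identity_plus_rank_one[OF unit[OF 2(1)], of 0 "M * d"] M d(1)
      by (simp add: spiked_def)
    then have tri: "M * d \<le> spec_norm p (\<lambda>i j. ?S i j - Sh x i j)
        + spec_norm p (\<lambda>i j. spiked M 0 (\<lambda>_. 0) i j - Sh x i j)" for x
      using spec_norm_triangle[of p ?S "spiked M 0 (\<lambda>_. 0)" "Sh x"] by simp
    have "space Q - A \<subseteq> ?E"
    proof
      fix x assume "x \<in> space Q - A"
      then show "x \<in> ?E" using tri[of x] by (auto simp: A_def)
    qed
    moreover have "?E \<in> sets (density Q (f \<omega>))"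
      by (rule sets_error_event[OF Sh]) (simp add: sQ)
    ultimately have "measure (density Q (f \<omega>)) (space Q - A) \<le> measure (density Q (f \<omega>)) ?E"
      by (rule D.finite_measure_mono)
    then have "1/4 \<le> err_prob n p (gaussian p ?S) ?S Sh (M * d / 2)"
      using 2 by (simp add: err_prob_def dens[OF 2(1)])
    then show ?thesis using 2(1) by blast
  qed
qed

subsection \<open>Minimax lower bounds\<close>

text \<open>The diagonal coupling costs nothing; so the statistical rate may be proved on
  uncontaminated data.\<close>

lemma gaussian_in_contam:
  assumes "0 \<le> \<epsilon>"
  shows "gaussian p S \<in> contam p S \<epsilon>"
proof -
  let ?P = "gaussian p S"
  interpret P: prob_space ?P by (rule prob_space_gaussian)
  define \<pi> where "\<pi> = distr ?P (Rp p \<Otimes>\<^sub>M Rp p) (\<lambda>x. (x, x))"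
  have [measurable_cong]: "sets ?P = sets (Rp p)" by simp
  have [measurable]: "(\<lambda>x. (x, x)) \<in> measurable ?P (Rp p \<Otimes>\<^sub>M Rp p)" by measurable
  have "\<pi> \<in> couplings p ?P ?P"
    unfolding couplings_def \<pi>_def
    by (auto simp: distr_distr o_def intro!: P.prob_space_distr distr_id2)
  then have "wass1 p ?P ?P \<le> (\<integral>\<^sup>+xy. ennreal (vnorm p (\<lambda>i. fst xy i - snd xy i)) \<partial>\<pi>)"
    unfolding wass1_def by (rule INF_lower)
  also have "\<dots> = 0"
  proof -
    have [measurable]: "(\<lambda>x. x i) \<in> borel_measurable (Rp p)" if "i < p" for i
      using that by (simp add: measurable_cong_sets[OF sets_Rp refl])
    have "(\<lambda>xy. ennreal (vnorm p (\<lambda>i. fst xy i - snd xy i))) \<in> borel_measurable (Rp p \<Otimes>\<^sub>M Rp p)"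
      unfolding vnorm_def by measurable
    then show ?thesis unfolding \<pi>_def
      by (subst nn_integral_distr) (auto simp: vnorm_def)
  qed
  finally show ?thesis
    using assms P.prob_space_axioms by (simp add: contam_def)
qed

section \<open>The two-point bound for the contamination level\<close>

definition unit_vec :: "nat \<Rightarrow> real" where
  "unit_vec i = (if i = 0 then 1 else 0)"

lemma sum_unit_vec_square: "1 \<le> p \<Longrightarrow> (\<Sum>i<p. (unit_vec i)\<^sup>2) = 1"
  by (simp add: unit_vec_def if_distrib[of "\<lambda>x. x\<^sup>2"] cong: if_cong)

lemma nn_integral_std_normal_abs_le: "(\<integral>\<^sup>+x. ennreal \<bar>x\<bar> \<partial>std_normal_distribution) \<le> 1"
proof -
  have "(\<integral>\<^sup>+x. ennreal \<bar>x\<bar> \<partial>std_normal_distribution) = ennreal (\<integral>x. \<bar>x\<bar> \<partial>std_normal_distribution)"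
    using integrable_abs[OF integrable_std_normal_distribution_moment[of 1]]
    by (intro nn_integral_eq_integral) auto
  also have "(\<integral>x. \<bar>x\<bar> \<partial>std_normal_distribution) = sqrt (2 / pi)"
    using std_normal_distribution_odd_moments_abs[of 0] by simp
  also have "\<dots> \<le> 1" using pi_gt3 by simp
  finally show ?thesis by (simp add: ennreal_leI order_trans)
qed

text \<open>One scalar Gaussian z drives both laws, with factors \<sigma> and \<sigma> + \<epsilon>
  along the first axis. This coupling costs \<epsilon> E |z|, and E |z| <= 1.\<close>

lemma gaussian_rank_one_in_contam:
  assumes p: "1 \<le> p" and "0 \<le> \<epsilon>"
  shows "gaussian p (spiked 0 (\<sigma>\<^sup>2) unit_vec) \<in> contam p (spiked 0 ((\<sigma> + \<epsilon>)\<^sup>2) unit_vec) \<epsilon>"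
proof -
  let ?Z = "PiM {0::nat} (\<lambda>_. std_normal_distribution)"
  interpret Z: prob_space ?Z by (rule prob_space_PiM_std_normal)
  interpret N: prob_space std_normal_distribution by (rule prob_space_std_normal)
  interpret PN: product_sigma_finite "\<lambda>_. std_normal_distribution" by standard
  define B where "B \<tau> i j = (if i = 0 \<and> j = 0 then \<tau> else 0 :: real)" for \<tau> and i j :: nat
  have law: "gaussian p (spiked 0 (\<tau>\<^sup>2) unit_vec) = distr ?Z (Rp p) (linear_image p {0} (B \<tau>))" for \<tau>
  proof (rule gaussian_eq_linear_image[where A="B \<tau>"])
    fix i l assume "i < p" "l < p"
    have "(\<Sum>j<p. B \<tau> i j * B \<tau> l j) = (\<Sum>j<p. if j = 0 then B \<tau> i 0 * B \<tau> l 0 else 0)"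
      by (intro sum.cong refl) (auto simp: B_def)
    then show "spiked 0 (\<tau>\<^sup>2) unit_vec i l = (\<Sum>j<p. B \<tau> i j * B \<tau> l j)"
      using p by (simp add: B_def spiked_def unit_vec_def power2_eq_square)
    show "spiked 0 (\<tau>\<^sup>2) unit_vec i l = (\<Sum>j\<in>{0}. B \<tau> i j * B \<tau> l j)"
      by (simp add: B_def spiked_def unit_vec_def power2_eq_square)
  qed simp
  let ?P = "gaussian p (spiked 0 (\<sigma>\<^sup>2) unit_vec)" and ?Q = "gaussian p (spiked 0 ((\<sigma> + \<epsilon>)\<^sup>2) unit_vec)"
  define \<phi> where "\<phi> z = (linear_image p {0} (B (\<sigma> + \<epsilon>)) z, linear_image p {0} (B \<sigma>) z)" for z
  have \<phi> [measurable]: "\<phi> \<in> measurable ?Z (Rp p \<Otimes>\<^sub>M Rp p)"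
    unfolding \<phi>_def[abs_def] by measurable
  have "distr ?Z (Rp p \<Otimes>\<^sub>M Rp p) \<phi> \<in> couplings p ?Q ?P"
    unfolding couplings_def law
    by (auto simp: distr_distr o_def \<phi>_def intro!: Z.prob_space_distr distr_cong)
  then have "wass1 p ?Q ?P \<le> (\<integral>\<^sup>+xy. ennreal (vnorm p (\<lambda>i. fst xy i - snd xy i)) \<partial>distr ?Z (Rp p \<Otimes>\<^sub>M Rp p) \<phi>)"
    unfolding wass1_def by (rule INF_lower)
  also have "\<dots> = (\<integral>\<^sup>+z. ennreal (vnorm p (\<lambda>i. fst (\<phi> z) i - snd (\<phi> z) i)) \<partial>?Z)"
  proof (rule nn_integral_distr[OF \<phi>])
    have [measurable]: "(\<lambda>x. x i) \<in> borel_measurable (Rp p)" if "i < p" for i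
      using that by (simp add: measurable_cong_sets[OF sets_Rp refl])
    show "(\<lambda>xy. ennreal (vnorm p (\<lambda>i. fst xy i - snd xy i))) \<in> borel_measurable (distr ?Z (Rp p \<Otimes>\<^sub>M Rp p) \<phi>)"
      unfolding vnorm_def by measurable
  qed
  also have "\<dots> = (\<integral>\<^sup>+z. ennreal \<epsilon> * ennreal \<bar>z 0\<bar> \<partial>?Z)"
  proof (rule nn_integral_cong)
    fix z :: "nat \<Rightarrow> real"
    have "vnorm p (\<lambda>i. fst (\<phi> z) i - snd (\<phi> z) i) = vnorm p (\<lambda>i. (\<epsilon> * z 0) * unit_vec i)"
      unfolding vnorm_def \<phi>_def linear_image_def
      by (intro arg_cong[where f=sqrt] sum.cong refl) (auto simp: B_def unit_vec_def algebra_simps)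
    also have "\<dots> = \<epsilon> * \<bar>z 0\<bar>"
      unfolding vnorm_scale using sum_unit_vec_square[OF p] assms(2) by (simp add: vnorm_def abs_mult)
    finally show "ennreal (vnorm p (\<lambda>i. fst (\<phi> z) i - snd (\<phi> z) i)) = ennreal \<epsilon> * ennreal \<bar>z 0\<bar>"
      using assms(2) by (simp add: ennreal_mult)
  qed
  also have "\<dots> = ennreal \<epsilon> * (\<integral>\<^sup>+z. ennreal \<bar>z 0\<bar> \<partial>?Z)"
    by (rule nn_integral_cmult) measurable
  also have "(\<integral>\<^sup>+z. ennreal \<bar>z 0\<bar> \<partial>?Z) = (\<integral>\<^sup>+x. ennreal \<bar>x\<bar> \<partial>std_normal_distribution)"
    by (rule PN.product_nn_integral_singleton) measurable
  also have "ennreal \<epsilon> * \<dots> \<le> ennreal \<epsilon> * 1"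
    by (intro mult_left_mono nn_integral_std_normal_abs_le) simp
  finally show ?thesis
    using prob_space_gaussian by (simp add: contam_def)
qed

text \<open>Under a common law of the data, no sample can put the estimate close to both matrices.
  The two error events thus cover the space and one has probability at least 1/2; the weaker 1/4 is
  the value shared with the spiked bound.\<close>

lemma two_point_lower_bound:
  assumes P: "prob_space P" "sets P = sets (Rp p)" and Sh: "estimator n p Sh"
    and sep: "2 * t \<le> spec_norm p (\<lambda>i j. S i j - S' i j)"
  shows "1/4 \<le> err_prob n p P S Sh t \<or> 1/4 \<le> err_prob n p P S' Sh t"
proof -
  define Q where "Q = PiM {..<n} (\<lambda>_. P)"
  interpret Q: prob_space Q unfolding Q_def by (intro prob_space_PiM P)
  have sQ: "sets Q = sets (sample_space n p)"
    unfolding Q_def by (rule sets_PiM_sample) (simp add: P)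
  let ?E = "\<lambda>S. {x \<in> space Q. t \<le> spec_norm p (\<lambda>i j. S i j - Sh x i j)}"
  have E: "?E S \<in> sets Q" for S by (rule sets_error_event[OF Sh sQ])
  have "x \<in> ?E S \<union> ?E S'" if "x \<in> space Q" for x
    using that sep spec_norm_triangle[of p S S' "Sh x"] by auto
  then have "space Q = ?E S \<union> ?E S'" by blast
  then have "1 = measure Q (?E S \<union> ?E S')" using Q.prob_space by simp
  also have "\<dots> \<le> measure Q (?E S) + measure Q (?E S')"
    by (rule measure_Un_le[OF E E])
  finally show ?thesis by (auto simp: err_prob_def Q_def)
qed

section \<open>From error probabilities to the minimax risk\<close>

lemma err_prob_antimono:
  assumes P: "prob_space P" "sets P = sets (Rp p)" and Sh: "estimator n p Sh" and "t \<le> t'"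
  shows "err_prob n p P S Sh t' \<le> err_prob n p P S Sh t"
proof -
  define Q where "Q = PiM {..<n} (\<lambda>_. P)"
  interpret Q: prob_space Q unfolding Q_def by (intro prob_space_PiM P)
  have sQ: "sets Q = sets (sample_space n p)"
    unfolding Q_def by (rule sets_PiM_sample) (simp add: P)
  show ?thesis
    unfolding err_prob_def Q_def[symmetric] using \<open>t \<le> t'\<close>
    by (intro Q.finite_measure_mono sets_error_event[OF Sh sQ]) auto
qed

text \<open>The supremum is taken in the reals, so the uniform bound 1 on error probabilities has to
  be supplied.\<close>

lemma SUP_err_prob_ge:
  assumes "S \<in> \<Theta>" "P \<in> contam p S \<epsilon>" "c \<le> err_prob n p P S Sh t"
  shows "c \<le> (SUP (S, P) \<in> {(S, P). S \<in> \<Theta> \<and> P \<in> contam p S \<epsilon>}. err_prob n p P S Sh t)"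
proof -
  have le: "err_prob n p P S Sh t \<le> 1" if "P \<in> contam p S \<epsilon>" for S P
  proof -
    interpret prob_space "PiM {..<n} (\<lambda>_. P)"
      using that by (intro prob_space_PiM) (auto simp: contam_def)
    show ?thesis unfolding err_prob_def by simp
  qed
  show ?thesis
  proof (rule cSUP_upper2[where x="(S, P)"])
    show "bdd_above ((\<lambda>(S, P). err_prob n p P S Sh t) ` {(S, P). S \<in> \<Theta> \<and> P \<in> contam p S \<epsilon>})"
      using le by (auto simp: bdd_above_def)
  qed (use assms in auto)
qed

text \<open>One entry per constraint: the first makes the spike amplitude R / 8 small, the second
  keeps M1 + M1 R / 8 within M2, the third keeps (sqrt M1 + \<epsilon>)^2 within M2.\<close>

definition radius :: "real \<Rightarrow> real \<Rightarrow> real" where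
  "radius M1 M2 = Min {1, (M2 - M1) / M1, sqrt M2 - sqrt M1}"

text \<open>Both entries come from half a separation: M d / 2 with d = R / 8 for the spikes, and
  sqrt M times \<epsilon> for the rank-one pair, whose distance is at least twice that.\<close>

definition sep_const :: "real \<Rightarrow> real" where
  "sep_const M = min (M / 16) (sqrt M)"

text \<open>The class enters only through \<open>pattern\<close>, a condition on v that puts every
  spiked matrix of admissible norm into it, and the statistical rate only through \<open>R\<close>.
  The larger of \<open>R\<close> and \<epsilon> decides which hypotheses are used, so spikes are
  demanded only when \<open>R\<close> is larger.\<close>

lemma minimax_lower_bound:
  assumes M: "0 < M1" "M1 < M2" and p: "1 \<le> p" and n: "1 \<le> n" and e: "0 \<le> \<epsilon>" and R: "max R \<epsilon> \<le> radius M1 M2"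
    and Sh: "estimator n p Sh"
    and \<Theta>: "\<And>a d v. psd p (spiked a d v) \<Longrightarrow> M1 \<le> spec_norm p (spiked a d v) \<Longrightarrow> spec_norm p (spiked a d v) \<le> M2 \<Longrightarrow>
       pattern v \<Longrightarrow> spiked a d v \<in> \<Theta>"
    and unit: "pattern unit_vec"
    and spikes: "\<epsilon> < R \<Longrightarrow> \<exists>s b. 1 \<le> s \<and> 1 \<le> b \<and> s * b \<le> p \<and> real n * R\<^sup>2 \<le> 4 * (real s * (1 + ln (real b)))
      \<and> (\<forall>\<omega>\<in>prior s b. pattern (spike_vec s b \<omega>))"
  shows "1/4 \<le> (SUP (S, P) \<in> {(S, P). S \<in> \<Theta> \<and> P \<in> contam p S \<epsilon>}. err_prob n p P S Sh (sep_const M1 * max R \<epsilon>))"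
proof -
  have in\<Theta>: "spiked a d v \<in> \<Theta>" if "(\<Sum>i<p. (v i)\<^sup>2) = 1" "0 \<le> a" "0 \<le> d" "M1 \<le> a + d" "a + d \<le> M2" "pattern v" for a d v
    using that psd_identity_plus_rank_one[of a d p v] spec_norm_identity_plus_rank_one[of v p a d]
    by (intro \<Theta>) (auto simp: spiked_def)
  have rad: "max R \<epsilon> \<le> 1" "max R \<epsilon> \<le> (M2 - M1) / M1" "max R \<epsilon> \<le> sqrt M2 - sqrt M1"
    using R by (auto simp: radius_def)
  have sup: ?thesis if "S \<in> \<Theta>" "P \<in> contam p S \<epsilon>" "1/4 \<le> err_prob n p P S Sh t" "sep_const M1 * max R \<epsilon> \<le> t" for S P t
    using that err_prob_antimono[OF _ _ Sh that(4), of P S]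
    by (intro SUP_err_prob_ge[OF that(1,2)]) (auto simp: contam_def)
  show ?thesis
  proof (cases "\<epsilon> < R")
    case False
    define S where "S = spiked 0 ((sqrt M1 + \<epsilon>)\<^sup>2) unit_vec"
    define S' where "S' = spiked 0 ((sqrt M1)\<^sup>2) unit_vec"
    have le: "M1 \<le> (sqrt M1 + \<epsilon>)\<^sup>2" "(sqrt M1 + \<epsilon>)\<^sup>2 \<le> M2"
      using M e rad(3) power_mono[of "sqrt M1" "sqrt M1 + \<epsilon>" 2] power_mono[of "sqrt M1 + \<epsilon>" "sqrt M2" 2] by auto
    have S: "S \<in> \<Theta>" "S' \<in> \<Theta>"
      using M le e unit sum_unit_vec_square[OF p] unfolding S_def S'_def by (auto intro!: in\<Theta>)
    have c: "gaussian p S' \<in> contam p S \<epsilon>" "gaussian p S' \<in> contam p S' \<epsilon>"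
      using gaussian_rank_one_in_contam[OF p e] gaussian_in_contam[OF e] by (auto simp: S_def S'_def)
    have diff: "(\<lambda>i j. S i j - S' i j) = spiked 0 (2 * sqrt M1 * \<epsilon> + \<epsilon>\<^sup>2) unit_vec"
      by (auto simp: S_def S'_def spiked_def fun_eq_iff power2_eq_square algebra_simps)
    have "spec_norm p (\<lambda>i j. S i j - S' i j) = 2 * sqrt M1 * \<epsilon> + \<epsilon>\<^sup>2"
      unfolding diff using spec_norm_identity_plus_rank_one[OF sum_unit_vec_square[OF p], of 0 "2 * sqrt M1 * \<epsilon> + \<epsilon>\<^sup>2"] M e
      by (simp add: spiked_def)
    then have sep: "2 * (sqrt M1 * \<epsilon>) \<le> spec_norm p (\<lambda>i j. S i j - S' i j)" by simp
    have t: "sep_const M1 * max R \<epsilon> \<le> sqrt M1 * \<epsilon>"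
      using False e by (auto simp: sep_const_def max_def intro!: mult_right_mono)
    from two_point_lower_bound[OF prob_space_gaussian sets_gaussian Sh sep, of S']
    show ?thesis using sup[OF S(1) c(1) _ t] sup[OF S(2) c(2) _ t] by blast
  next
    case True
    then have R0: "0 < R" using e by simp
    obtain s b where sb: "1 \<le> s" "1 \<le> b" "s * b \<le> p" "real n * R\<^sup>2 \<le> 4 * (real s * (1 + ln (real b)))"
      and pat: "\<forall>\<omega>\<in>prior s b. pattern (spike_vec s b \<omega>)"
      using spikes[OF True] by blast
    \<comment> \<open>The divisor 8 makes 16 n d^2 equal to n R^2 / 4, which absorbs the factor 4
      allowed in \<open>spikes\<close>.\<close>
    define d where "d = R / 8"
    have d: "0 \<le> d" "d\<^sup>2 \<le> 1/2" "16 * real n * d\<^sup>2 \<le> real s * (1 + ln (real b))"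
      using R0 rad(1) True sb(4) power_mono[of R 1 2] by (auto simp: d_def power_divide)
    have Md: "M1 + M1 * d \<le> M2"
    proof -
      have "M1 * d \<le> M1 * R" using M R0 by (simp add: d_def)
      also have "\<dots> \<le> M2 - M1" using rad(2) True M by (simp add: field_simps)
      finally show ?thesis by simp
    qed
    have t: "sep_const M1 * max R \<epsilon> \<le> M1 * d / 2"
    proof -
      have "sep_const M1 * R \<le> M1 / 16 * R" using R0 by (intro mult_right_mono) (auto simp: sep_const_def)
      then show ?thesis using True by (simp add: d_def max_def)
    qed
    \<comment> \<open>For d = 0 every vector gives the same matrix; \<open>unit_vec\<close> has the
      unit length and the pattern that \<open>in\<Theta>\<close> asks for.\<close>
    have null: "spiked M1 0 (\<lambda>_. 0) = spiked M1 0 unit_vec" by (simp add: spiked_def)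
    have "S \<in> \<Theta>" if "S \<in> insert (spiked M1 0 (\<lambda>_. 0)) ((\<lambda>\<omega>. spiked M1 (M1 * d) (spike_vec s b \<omega>)) ` prior s b)" for S
      using that
    proof safe
      show "spiked M1 0 (\<lambda>_. 0) \<in> \<Theta>" unfolding null
        using M unit sum_unit_vec_square[OF p] by (intro in\<Theta>) auto
      fix \<omega> assume w: "\<omega> \<in> prior s b"
      show "spiked M1 (M1 * d) (spike_vec s b \<omega>) \<in> \<Theta>"
        using M d(1) Md pat w sum_spike_vec_square[OF sb(1-3) w] by (intro in\<Theta>) auto
    qed
    then obtain S where "S \<in> \<Theta>" "1/4 \<le> err_prob n p (gaussian p S) S Sh (M1 * d / 2)"
      using spike_lower_bound[OF M(1) sb(1-3) d Sh] by blast
    then show ?thesis using sup[OF _ gaussian_in_contam[OF e] _ t] by blast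
  qed
qed

text \<open>A single block leaves a single nonzero entry, so v v^T is diagonal and the spiked matrix
  is banded for every k, including k = 0.\<close>

lemma spike_vec_one_eq_zero:
  assumes "i < b" "j < b" "i \<noteq> j"
  shows "spike_vec 1 b \<omega> i * spike_vec 1 b \<omega> j = 0"
  using assms by (auto simp: spike_vec_def)

text \<open>An inclusion is enough, since the image has at most s elements: the support can serve as
  the index set of the sparse class.\<close>

lemma support_spike_vec:
  assumes "1 \<le> b"
  shows "{q. spike_vec s b \<omega> q \<noteq> 0} \<subseteq> (\<lambda>i. i * b + fst (\<omega> i)) ` {..<s}"
proof
  fix q assume "q \<in> {q. spike_vec s b \<omega> q \<noteq> 0}"
  then have "q < s * b" "fst (\<omega> (q div b)) = q mod b" by (auto simp: spike_vec_def split: if_splits)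
  then show "q \<in> (\<lambda>i. i * b + fst (\<omega> i)) ` {..<s}"
    using assms by (intro image_eqI[of _ _ "q div b"]) (auto simp: less_mult_imp_div_less)
qed

theorem theorem13:
  fixes M1 M2 :: real
  assumes "0 < M1" and "M1 < M2"
  shows "(\<exists>c0>0. \<exists>C1>0. \<exists>c1>0. \<forall>(n::nat) (p::nat) (k::nat) (\<epsilon>::real).
            1 \<le> n \<longrightarrow> 2 * k < p \<longrightarrow> 0 \<le> \<epsilon> \<longrightarrow>
            max (sqrt ((real k + ln (real p)) / real n)) \<epsilon> \<le> c0 \<longrightarrow>
            (\<forall>Sh. estimator n p Sh \<longrightarrow>
               (SUP (S, P) \<in> {(S, P). S \<in> Theta1 p k M1 M2 \<and> P \<in> contam p S \<epsilon>}.
                   err_prob n p P S Sh (C1 * max (sqrt ((real k + ln (real p)) / real n)) \<epsilon>))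
                 \<ge> c1))
       \<and> (\<exists>c0>0. \<exists>C2>0. \<exists>c2>0. \<forall>(n::nat) (p::nat) (k::nat) (\<epsilon>::real).
            1 \<le> n \<longrightarrow> 2 * k < p \<longrightarrow> 0 \<le> \<epsilon> \<longrightarrow>
            max (sqrt ((real k + real k * ln (real p / real k)) / real n)) \<epsilon> \<le> c0 \<longrightarrow>
            (\<forall>Sh. estimator n p Sh \<longrightarrow>
               (SUP (S, P) \<in> {(S, P). S \<in> Theta2 p k M1 M2 \<and> P \<in> contam p S \<epsilon>}.
                   err_prob n p P S Sh
                     (C2 * max (sqrt ((real k + real k * ln (real p / real k)) / real n)) \<epsilon>))
                 \<ge> c2))"
proof -
  have r0: "0 < radius M1 M2" "0 < sep_const M1"
    using assms by (auto simp: radius_def sep_const_def)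
  show ?thesis
  proof (rule conjI; (rule exI[of _ "radius M1 M2"], rule conjI[OF r0(1)],
        rule exI[of _ "sep_const M1"], rule conjI[OF r0(2)], rule exI[of _ "1/4"], rule conjI, simp,
        intro allI impI))
    fix n p k :: nat and \<epsilon> :: real and Sh
    let ?R = "sqrt ((real k + ln (real p)) / real n)"
    assume n: "1 \<le> n" and kp: "2 * k < p" and e: "0 \<le> \<epsilon>" and R: "max ?R \<epsilon> \<le> radius M1 M2" and Sh: "estimator n p Sh"
    have p: "1 \<le> p" using kp by simp
    have nR: "real n * ?R\<^sup>2 = real k + ln (real p)" using n p by simp
    define pattern where "pattern v \<longleftrightarrow> (\<forall>i<p. \<forall>j<p. \<bar>int i - int j\<bar> > int k \<longrightarrow> v i * v j = (0::real))" for v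
    show "1/4 \<le> (SUP (S, P) \<in> {(S, P). S \<in> Theta1 p k M1 M2 \<and> P \<in> contam p S \<epsilon>}.
        err_prob n p P S Sh (sep_const M1 * max ?R \<epsilon>))"
    proof (rule minimax_lower_bound[OF assms p n e R Sh, where pattern = pattern])
      fix a d v assume "psd p (spiked a d v)" "M1 \<le> spec_norm p (spiked a d v)" "spec_norm p (spiked a d v) \<le> M2" "pattern v"
      then show "spiked a d v \<in> Theta1 p k M1 M2"
        by (auto simp: Theta1_def pattern_def spiked_def mult.assoc)
    next
      show "pattern unit_vec" by (auto simp: pattern_def unit_vec_def)
    next
      show "\<exists>s b. 1 \<le> s \<and> 1 \<le> b \<and> s * b \<le> p \<and> real n * ?R\<^sup>2 \<le> 4 * (real s * (1 + ln (real b)))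
        \<and> (\<forall>\<omega>\<in>prior s b. pattern (spike_vec s b \<omega>))"
      \<comment> \<open>The sum k + ln p is at most twice its larger term. If that is ln p, hiding
        one entry among p positions suffices; if it is k, signs on the first k coordinates suffice,
        whose k by k block lies within the band.\<close>
      proof (cases "real k \<le> ln (real p)")
        case True
        have pat: "pattern (spike_vec 1 p \<omega>)" for \<omega>
          unfolding pattern_def using spike_vec_one_eq_zero by fastforce
        show ?thesis unfolding nR
          by (rule exI[of _ 1], rule exI[of _ p]) (use p True pat in auto)
      next
        case False
        moreover have "0 \<le> ln (real p)" using p by simp
        ultimately have "1 \<le> k" by (cases k) auto
        moreover have "pattern (spike_vec k 1 \<omega>)" for \<omega>
          by (auto simp: pattern_def spike_vec_def)
        ultimately show ?thesis unfolding nR using kp False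
          by (intro exI[of _ k] exI[of _ 1]) auto
      qed
    qed
  next
    fix n p k :: nat and \<epsilon> :: real and Sh
    let ?R = "sqrt ((real k + real k * ln (real p / real k)) / real n)"
    assume n: "1 \<le> n" and kp: "2 * k < p" and e: "0 \<le> \<epsilon>" and R: "max ?R \<epsilon> \<le> radius M1 M2" and Sh: "estimator n p Sh"
    have p: "1 \<le> p" using kp by simp
    define pattern where "pattern v \<longleftrightarrow> (\<exists>I. I \<subseteq> {..<p} \<and> card I \<le> k \<and>
        (\<forall>i<p. \<forall>j<p. i \<noteq> j \<and> v i * v j \<noteq> (0::real) \<longrightarrow> i \<in> I \<and> j \<in> I))" for v
    show "1/4 \<le> (SUP (S, P) \<in> {(S, P). S \<in> Theta2 p k M1 M2 \<and> P \<in> contam p S \<epsilon>}.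
        err_prob n p P S Sh (sep_const M1 * max ?R \<epsilon>))"
    proof (rule minimax_lower_bound[OF assms p n e R Sh, where pattern = pattern])
      fix a d v assume "psd p (spiked a d v)" "M1 \<le> spec_norm p (spiked a d v)" "spec_norm p (spiked a d v) \<le> M2" "pattern v"
      then show "spiked a d v \<in> Theta2 p k M1 M2"
        unfolding Theta2_def pattern_def spiked_def by (auto simp: mult.assoc)
    next
      show "pattern unit_vec"
        \<comment> \<open>The matrix is diagonal, so the empty index set serves, also for k =
          0.\<close>
        unfolding pattern_def by (rule exI[of _ "{}"]) (auto simp: unit_vec_def)
    next
      assume "\<epsilon> < ?R"
      \<comment> \<open>For k = 0 the statistical rate is 0, and only the bound by \<epsilon>
        remains.\<close>
      then have k: "1 \<le> k" using e by (cases k) auto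
      \<comment> \<open>Rounding p / k down to \<open>b\<close> costs a factor below 2, since p < k
        (b + 1) <= 2 k b. Hence ln (p / k) exceeds ln b by at most ln 2, and 1 + ln (p / k) <= 2 +
        ln b stays within the allowed factor 4.\<close>
      define b where "b = p div k"
      have b: "2 \<le> b" using kp k unfolding b_def by (subst less_eq_div_iff_mult_less_eq) auto
      have kb: "k * b \<le> p" by (simp add: b_def)
      have "p < k * (b + 1)" using k dividend_less_times_div[of k p] by (simp add: b_def)
      then have "real p < real k * real (b + 1)" by (metis of_nat_less_iff of_nat_mult)
      also have "\<dots> \<le> real k * (2 * real b)" using b by (intro mult_left_mono) auto
      finally have "real p / real k \<le> 2 * real b" using k by (simp add: field_simps)
      then have "ln (real p / real k) \<le> ln (2 * real b)" using k p b by (subst ln_le_cancel_iff) auto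
      also have "\<dots> = ln 2 + ln (real b)" using b by (simp add: ln_mult)
      also have "\<dots> \<le> 1 + ln (real b)" using ln_2_less_1 by simp
      finally have "ln (real p / real k) \<le> 1 + ln (real b)" .
      moreover have "0 \<le> ln (real b)" using b by simp
      moreover have "x \<le> 1 + y \<Longrightarrow> 0 \<le> y \<Longrightarrow> 1 + x \<le> 4 * (1 + y)" for x y :: real by simp
      ultimately have ln: "1 + ln (real p / real k) \<le> 4 * (1 + ln (real b))" by blast
      have "0 \<le> ln (real p / real k)" using k kp by (intro ln_ge_zero) auto
      then have "?R\<^sup>2 = (real k + real k * ln (real p / real k)) / real n"
        by (intro real_sqrt_pow2 divide_nonneg_nonneg add_nonneg_nonneg mult_nonneg_nonneg) auto
      then have "real n * ?R\<^sup>2 = real k * (1 + ln (real p / real k))"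
        using n by (simp only: distrib_left) simp
      also have "\<dots> \<le> 4 * (real k * (1 + ln (real b)))"
        using mult_left_mono[OF ln, of "real k"] by (simp only: of_nat_0_le_iff mult.left_commute)
      finally have 1: "real n * ?R\<^sup>2 \<le> 4 * (real k * (1 + ln (real b)))" .
      have "pattern (spike_vec k b \<omega>)" for \<omega>
        unfolding pattern_def
      proof (intro exI conjI)
        let ?I = "{q. spike_vec k b \<omega> q \<noteq> 0}"
        show "?I \<subseteq> {..<p}" using kb by (auto simp: spike_vec_def split: if_splits)
        have "card ?I \<le> card ((\<lambda>i. i * b + fst (\<omega> i)) ` {..<k})"
          using b by (intro card_mono support_spike_vec) auto
        also have "\<dots> \<le> k" using card_image_le[of "{..<k}"] by simp
        finally show "card ?I \<le> k" .
      qed auto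
      then show "\<exists>s b. 1 \<le> s \<and> 1 \<le> b \<and> s * b \<le> p \<and> real n * ?R\<^sup>2 \<le> 4 * (real s * (1 + ln (real b)))
        \<and> (\<forall>\<omega>\<in>prior s b. pattern (spike_vec s b \<omega>))"
        using k b kb 1 by (intro exI[of _ k] exI[of _ b]) auto
    qed
  qed
qed

end
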